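(* For each $\epsilon>0$ there exists $\delta>0$ such that the following holds. Let $q,p\in(\epsilon,1-\epsilon)$ with $p>q+\epsilon$, and let $f,g:\{0,1\}^n\to[0,1]$. Suppose that \[\mathbb{E}_{(\mathbf{x},\mathbf{y})\sim D(q,p)}\big[(1-g(\mathbf{y}))f(\mathbf{x})\big]<\delta,\] and that $f$ is $\left(\lceil 1/\delta\rceil,\delta,\mu_q\right)$-regular. Then either $\mu_q(f)<\epsilon$ or $\mu_p(g)>1-\epsilon$.
   Context: $\mu_p$ is the $p$-biased product measure on $\{0,1\}^n$ and $\mu_p(f)=\mathbb{E}_{\mathbf{x}\sim\mu_p}[f(\mathbf{x})]$. For $q<p$, $D(q,p)$ is the distribution of $(\mathbf{x},\mathbf{y})$ in which the pairs $(\mathbf{x}_i,\mathbf{y}_i)$ are independent, $\mathbf{x}_i\le\mathbf{y}_i$ always, $\Pr[\mathbf{x}_i=1]=q$, $\Pr[\mathbf{y}_i=1]=p$. For $R\subseteq[n]$ and $y\in\{0,1\}^R$, $f_{R\to y}:\{0,1\}^{[n]\setminus R}\to[0,1]$ is $f_{R\to y}(x)=f(z)$ where $z$ agrees with $y$ on $R$ and with $x$ off $R$. $f$ is $(r,\epsilon,\mu_p)$-regular if $|\mu_p(f_{J\to y})-\mu_p(f)|<\epsilon$ for every $J\subseteq[n]$ with $|J|\le r$ and every $y\in\{0,1\}^J$. *)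

theory Defs
  imports "HOL-Probability.Probability"
begin

text \<open>
  A point of \<open>{0,1}\<^sup>I\<close> is a function to \<^typ>\<open>bool\<close> (\<^const>\<open>True\<close> is 1), normalised to
  \<^const>\<open>False\<close> outside \<open>I\<close>. The order \<^const>\<open>False\<close> \<open>\<le>\<close> \<^const>\<open>True\<close> is that of \<open>{0,1}\<close>.
\<close>

definition cube :: "'a set \<Rightarrow> ('a \<Rightarrow> bool) set" where
  "cube I = PiE_dflt I False (\<lambda>_. UNIV)"

definition biased :: "'a set \<Rightarrow> real \<Rightarrow> ('a \<Rightarrow> bool) pmf" where
  "biased I p = Pi_pmf I False (\<lambda>_. bernoulli_pmf p)"

definition mean :: "'a set \<Rightarrow> real \<Rightarrow> (('a \<Rightarrow> bool) \<Rightarrow> real) \<Rightarrow> real" where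
  "mean I p f = measure_pmf.expectation (biased I p) f"

text \<open>
  The law of one pair \<open>(x\<^sub>i, y\<^sub>i)\<close>: draw \<open>y\<^sub>i\<close> with bias \<open>p\<close>, and keep a 1 with probability
  \<open>q / p\<close> to get \<open>x\<^sub>i\<close>. For \<open>0 \<le> q < p \<le> 1\<close> it is the only law with \<open>x\<^sub>i \<le> y\<^sub>i\<close> and marginal
  biases \<open>q\<close> and \<open>p\<close>; see \<open>coupled_bit_le\<close>, \<open>coupled_bit_fst\<close>, \<open>coupled_bit_snd\<close> and
  \<open>coupled_bit_unique\<close> below.
\<close>

definition coupled_bit :: "real \<Rightarrow> real \<Rightarrow> (bool \<times> bool) pmf" where
  "coupled_bit q p =
     map_pmf (\<lambda>(y, k). (y \<and> k, y)) (pair_pmf (bernoulli_pmf p) (bernoulli_pmf (q / p)))"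

definition coupled :: "'a set \<Rightarrow> real \<Rightarrow> real \<Rightarrow> (('a \<Rightarrow> bool) \<times> ('a \<Rightarrow> bool)) pmf" where
  "coupled I q p =
     map_pmf (\<lambda>w. (\<lambda>i. fst (w i), \<lambda>i. snd (w i))) (Pi_pmf I (False, False) (\<lambda>_. coupled_bit q p))"

text \<open>The restriction \<open>f\<^bsub>R\<rightarrow>y\<^esub>\<close>, a function on \<open>{0,1}\<close> to the power \<open>I - R\<close>.\<close>

definition restriction ::
    "(('a \<Rightarrow> bool) \<Rightarrow> real) \<Rightarrow> 'a set \<Rightarrow> ('a \<Rightarrow> bool) \<Rightarrow> ('a \<Rightarrow> bool) \<Rightarrow> real" where
  "restriction f R y = (\<lambda>x. f (override_on x y R))"

definition regular ::
    "'a set \<Rightarrow> nat \<Rightarrow> real \<Rightarrow> real \<Rightarrow> (('a \<Rightarrow> bool) \<Rightarrow> real) \<Rightarrow> bool" where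
  "regular I r \<epsilon> p f \<longleftrightarrow>
     (\<forall>J y. J \<subseteq> I \<and> card J \<le> r \<and> y \<in> cube J \<longrightarrow>
        \<bar>mean (I - J) p (restriction f J y) - mean I p f\<bar> < \<epsilon>)"

lemma coupled_bit_le: "(x, y) \<in> set_pmf (coupled_bit q p) \<Longrightarrow> x \<le> y"
  by (auto simp: coupled_bit_def)

lemma coupled_bit_snd: "map_pmf snd (coupled_bit q p) = bernoulli_pmf p"
proof -
  have "map_pmf snd (coupled_bit q p) =
      map_pmf fst (pair_pmf (bernoulli_pmf p) (bernoulli_pmf (q / p)))"
    unfolding coupled_bit_def map_pmf_comp by (intro map_pmf_cong) auto
  then show ?thesis by (simp add: map_fst_pair_pmf)
qed

lemma coupled_bit_fst:
  assumes "0 \<le> q" "q < p" "p \<le> 1"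
  shows "map_pmf fst (coupled_bit q p) = bernoulli_pmf q"
proof -
  have v: "(\<lambda>z. fst (case z of (y, k) \<Rightarrow> (y \<and> k, y))) -` {True} = {(True, True)}"
    by (auto simp: vimage_def split: prod.splits)
  have "pmf (map_pmf fst (coupled_bit q p)) True =
      measure (measure_pmf (pair_pmf (bernoulli_pmf p) (bernoulli_pmf (q / p)))) {(True, True)}"
    unfolding coupled_bit_def map_pmf_comp pmf_map v ..
  also have "\<dots> = pmf (bernoulli_pmf p) True * pmf (bernoulli_pmf (q / p)) True"
    unfolding measure_pmf_single pmf_pair ..
  also have "\<dots> = q"
    using assms by simp
  finally have "pmf (map_pmf fst (coupled_bit q p)) True = q" .
  then have "\<forall>b. pmf (map_pmf fst (coupled_bit q p)) b = pmf (bernoulli_pmf q) b"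
    unfolding all_bool_eq pmf_False_conv_True using assms by simp
  then show ?thesis by (intro pmf_eqI) blast
qed

lemma coupled_bit_unique:
  assumes "0 \<le> q" "q < p" "p \<le> 1"
    and le: "\<And>x y. (x, y) \<in> set_pmf D \<Longrightarrow> x \<le> y"
    and D1: "map_pmf fst D = bernoulli_pmf q" and D2: "map_pmf snd D = bernoulli_pmf p"
  shows "D = coupled_bit q p"
proof -
  have determined:
    "pmf E (True, False) = 0 \<and> pmf E (True, True) = q \<and> pmf E (False, True) = p - q
      \<and> pmf E (False, False) = 1 - p"
    if le: "\<And>x y. (x, y) \<in> set_pmf E \<Longrightarrow> x \<le> y"
      and E1: "map_pmf fst E = bernoulli_pmf q" and E2: "map_pmf snd E = bernoulli_pmf p"
    for E :: "(bool \<times> bool) pmf"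
  proof -
    have 0: "pmf E (True, False) = 0"
      using le[of True False] by (auto simp: set_pmf_iff)
    have v: "fst -` {b} = {(b, True), (b, False)}" "snd -` {b} = {(True, b), (False, b)}"
      for b :: bool by (simp_all add: set_eq_iff) blast+
    have m1: "pmf (bernoulli_pmf q) b = pmf E (b, True) + pmf E (b, False)" for b
      unfolding E1[symmetric] pmf_map v by (simp add: measure_measure_pmf_finite)
    have m2: "pmf (bernoulli_pmf p) b = pmf E (True, b) + pmf E (False, b)" for b
      unfolding E2[symmetric] pmf_map v by (simp add: measure_measure_pmf_finite)
    show ?thesis
      using 0 m1[of True] m2[of True] m2[of False] assms(1-3) by simp
  qed
  note d = determined[OF le D1 D2]
    and c = determined[OF coupled_bit_le coupled_bit_fst[OF assms(1-3)] coupled_bit_snd]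
  have "\<forall>a b. pmf D (a, b) = pmf (coupled_bit q p) (a, b)"
    unfolding all_bool_eq using d c by (simp only: simp_thms)
  then show ?thesis by (intro pmf_eqI) auto
qed

end

theory Submission
  imports Defs
begin

text \<open>
  Let \<open>F\<^sub>t(y)\<close> be the conditional expectation of \<open>f(x)\<close> given \<open>y\<close> for \<open>(x,y)\<close> distributed as
  \<open>D(q,t)\<close>. The expectation in the hypothesis is that of \<open>(1 - g) F\<^sub>p\<close>, so it suffices to show that
  \<open>F\<^sub>p\<close> is rarely tiny. Fix a small \<open>\<eta>\<close> and put \<open>L\<^sub>t = ln (F\<^sub>t + \<eta>)\<close>, \<open>m(t) = E L\<^sub>t\<close>. Then \<open>m'(t)\<close>
  is a sum over the coordinates of Bregman divergences of \<open>ln\<close>, and as long as the discrete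
  derivatives of \<open>F\<^sub>t\<close> rarely exceed \<open>\<eta> / 2\<close>, the Poincare inequality bounds it from below by
  \<open>Var L\<^sub>t - 1\<close>. The mean of \<open>F\<^sub>t\<close> does not depend on \<open>t\<close>, so \<open>F\<^sub>t\<close> is bounded away from 0 with
  probability bounded away from 0, and therefore \<open>Var L\<^sub>t \<ge> c (m(t) + C)\<^sup>2\<close> when \<open>m(t)\<close> is very
  negative. Solutions of \<open>m' \<ge> c (m + C)\<^sup>2 - 1\<close> come up from minus infinity in bounded time, which
  bounds \<open>m(p)\<close> from below independently of \<open>\<eta>\<close>; Markov's inequality concludes.

  Large discrete derivatives are rare by Bonami's lemma if all low-degree influences of \<open>f\<close> are small.
  In general one first exposes a bounded set \<open>J\<close> of coordinates such that almost all
  sections of \<open>f\<close> over \<open>J\<close> have small low-degree influences. By regularity these sections have almost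
  the same mean as \<open>f\<close>, and by concavity of \<open>ln\<close> the lower bound for them passes to \<open>f\<close>.
\<close>

subsection \<open>Biased expectations and Fourier expansion\<close>

text \<open>
  Points of the cube are represented as subsets of \<open>V\<close>. For a point \<open>y\<close>, \<open>bexp (q / t) y f\<close> is the
  conditional expectation of \<open>f(x)\<close> given \<open>y\<close> under \<open>D(q,t)\<close>.
\<close>

definition bexp :: "real \<Rightarrow> 'a set \<Rightarrow> ('a set \<Rightarrow> real) \<Rightarrow> real" where
  "bexp t V f = (\<Sum>x\<in>Pow V. t ^ card x * (1 - t) ^ card (V - x) * f x)"

lemma sum_Pow_insert:
  assumes "finite V" "i \<notin> V"
  shows "(\<Sum>x\<in>Pow (insert i V). g x) = (\<Sum>x\<in>Pow V. g x) + (\<Sum>x\<in>Pow V. g (insert i x))"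
proof -
  have "inj_on (insert i) (Pow V)"
    using assms(2) by (intro inj_onI) (metis PowD insert_ident subsetD)
  moreover have "Pow V \<inter> insert i ` Pow V = {}"
    using assms(2) by auto
  ultimately show ?thesis
    using assms(1) by (simp add: Pow_insert sum.union_disjoint sum.reindex)
qed

lemma bexp_empty [simp]: "bexp t {} f = f {}"
  by (simp add: bexp_def)

lemma bexp_cong: "(\<And>x. x \<subseteq> V \<Longrightarrow> f x = g x) \<Longrightarrow> bexp t V f = bexp t V g"
  by (simp add: bexp_def)

lemma bexp_insert:
  assumes "finite V" "i \<notin> V"
  shows "bexp t (insert i V) f = t * bexp t V (\<lambda>x. f (insert i x)) + (1 - t) * bexp t V f"
proof -
  have 1: "t ^ card x * (1 - t) ^ card (insert i V - x) * f x
      = (1 - t) * (t ^ card x * (1 - t) ^ card (V - x) * f x)" if "x \<in> Pow V" for x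
  proof -
    have "insert i V - x = insert i (V - x)" using that assms by auto
    then show ?thesis using assms by simp
  qed
  have 2: "t ^ card (insert i x) * (1 - t) ^ card (insert i V - insert i x) * f (insert i x)
      = t * (t ^ card x * (1 - t) ^ card (V - x) * f (insert i x))" if "x \<in> Pow V" for x
  proof -
    have "insert i V - insert i x = V - x" "i \<notin> x" "finite x"
      using that assms finite_subset by auto
    then show ?thesis by simp
  qed
  show ?thesis
    unfolding bexp_def sum_Pow_insert[OF assms] sum_distrib_left
    by (subst add.commute) (intro arg_cong2[where f = "(+)"] sum.cong refl 1 2)
qed

lemma bexp_remove:
  assumes "finite V" "i \<in> V"
  shows "bexp t V f
    = t * bexp t (V - {i}) (\<lambda>x. f (insert i x)) + (1 - t) * bexp t (V - {i}) f"
  using bexp_insert[of "V - {i}" i t f] assms by (simp add: insert_absorb)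

lemma bexp_add: "bexp t V (\<lambda>x. f x + g x) = bexp t V f + bexp t V g"
  by (simp add: bexp_def algebra_simps sum.distrib)

lemma bexp_diff: "bexp t V (\<lambda>x. f x - g x) = bexp t V f - bexp t V g"
  by (simp add: bexp_def algebra_simps sum_subtractf)

lemma bexp_cmult: "bexp t V (\<lambda>x. c * f x) = c * bexp t V f"
  by (simp add: bexp_def algebra_simps sum_distrib_left)

lemma bexp_divide: "bexp t V (\<lambda>x. f x / c) = bexp t V f / c"
  by (simp add: bexp_def sum_divide_distrib)

lemma bexp_minus: "bexp t V (\<lambda>x. - f x) = - bexp t V f"
  using bexp_cmult[of t V "-1" f] by simp

lemma bexp_sum: "bexp t V (\<lambda>x. \<Sum>i\<in>A. f i x) = (\<Sum>i\<in>A. bexp t V (f i))"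
  unfolding bexp_def sum_distrib_left by (rule sum.swap)

lemma bexp_const: "finite V \<Longrightarrow> bexp t V (\<lambda>x. c) = c"
  by (induction V rule: finite_induct) (auto simp: bexp_insert algebra_simps)

lemma bexp_mono:
  assumes "0 \<le> t" "t \<le> 1" "\<And>x. x \<subseteq> V \<Longrightarrow> f x \<le> g x"
  shows "bexp t V f \<le> bexp t V g"
  unfolding bexp_def using assms by (intro sum_mono mult_left_mono) auto

lemma bexp_nonneg:
  assumes "0 \<le> t" "t \<le> 1" "\<And>x. x \<subseteq> V \<Longrightarrow> 0 \<le> f x"
  shows "0 \<le> bexp t V f"
  unfolding bexp_def using assms by (intro sum_nonneg) auto

lemma bexp_in_01:
  assumes "finite V" "0 \<le> t" "t \<le> 1" "\<And>x. x \<subseteq> V \<Longrightarrow> f x \<in> {0..1}"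
  shows "bexp t V f \<in> {0..1}"
  using bexp_nonneg[of t V f] bexp_mono[of t V f "\<lambda>_. 1"] assms by (auto simp: bexp_const)

lemma bexp_Un:
  assumes "finite J" "finite K" "J \<inter> K = {}"
  shows "bexp t (J \<union> K) f = bexp t J (\<lambda>a. bexp t K (\<lambda>b. f (a \<union> b)))"
  using assms
proof (induction J arbitrary: f rule: finite_induct)
  case (insert j J)
  then have "finite (J \<union> K)" "j \<notin> J \<union> K" "J \<inter> K = {}" by auto
  with insert show ?case
    by (simp add: bexp_insert)
qed simp

text \<open>Keeping each element of a \<open>t\<close>-random set independently with probability
  \<open>u\<close> leaves a \<open>t * u\<close>-random set. With \<open>u = q / t\<close> this is
  why the mean of \<open>F\<^sub>t\<close> does not depend on \<open>t\<close>.\<close>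

lemma bexp_tower:
  assumes "finite V"
  shows "bexp t V (\<lambda>y. bexp u y f) = bexp (t * u) V f"
  using assms
proof (induction V arbitrary: f rule: finite_induct)
  case (insert j V)
  have "bexp u (insert j y) f = u * bexp u y (\<lambda>x. f (insert j x)) + (1 - u) * bexp u y f"
    if "y \<subseteq> V" for y
    using that insert.hyps finite_subset by (intro bexp_insert) auto
  then have "bexp t V (\<lambda>y. bexp u (insert j y) f)
      = u * bexp (t * u) V (\<lambda>x. f (insert j x)) + (1 - u) * bexp (t * u) V f"
    by (simp add: bexp_add bexp_cmult insert.IH cong: bexp_cong)
  then show ?case
    unfolding bexp_insert[OF insert.hyps] insert.IH \<open>bexp t V (\<lambda>y. bexp u (insert j y) f) = _\<close>
    by (simp add: algebra_simps)
qed simp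

lemma bexp_Cauchy_Schwarz:
  assumes "0 \<le> t" "t \<le> 1"
  shows "(bexp t V (\<lambda>x. f x * g x))\<^sup>2 \<le> bexp t V (\<lambda>x. (f x)\<^sup>2) * bexp t V (\<lambda>x. (g x)\<^sup>2)"
proof -
  define w where "w x = t ^ card x * (1 - t) ^ card (V - x)" for x :: "'a set"
  have w: "sqrt (w x) * sqrt (w x) = w x" for x
    unfolding w_def using assms by simp
  have "(\<Sum>x\<in>Pow V. (sqrt (w x) * f x) * (sqrt (w x) * g x))\<^sup>2
      \<le> (\<Sum>x\<in>Pow V. (sqrt (w x) * f x)\<^sup>2) * (\<Sum>x\<in>Pow V. (sqrt (w x) * g x)\<^sup>2)"
    by (rule Cauchy_Schwarz_ineq_sum)
  moreover have "(sqrt (w x) * a) * (sqrt (w x) * b) = w x * (a * b)" for x a b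
    using w[of x] by (metis mult.assoc mult.left_commute)
  ultimately show ?thesis unfolding bexp_def w_def power2_eq_square by simp
qed

lemma bexp_square_le:
  assumes "finite V" "0 \<le> t" "t \<le> 1"
  shows "(bexp t V f)\<^sup>2 \<le> bexp t V (\<lambda>x. (f x)\<^sup>2)"
  using bexp_Cauchy_Schwarz[of t V f "\<lambda>_. 1"] assms by (simp add: bexp_const)

section \<open>Fourier expansion in biased characters\<close>

text \<open>
  The characters are not normalised (their variance is \<open>(t (1 - t)) ^ card S\<close>); in this way
  conditional expectation multiplies coefficients by a power of \<open>q / t\<close>, without square roots.
\<close>

definition chi :: "real \<Rightarrow> 'a set \<Rightarrow> 'a set \<Rightarrow> real" where
  "chi t S x = (\<Prod>i\<in>S. of_bool (i \<in> x) - t)"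

definition four :: "real \<Rightarrow> 'a set \<Rightarrow> ('a set \<Rightarrow> real) \<Rightarrow> 'a set \<Rightarrow> real" where
  "four t V a x = (\<Sum>S\<in>Pow V. a S * chi t S x)"

definition coef :: "real \<Rightarrow> 'a set \<Rightarrow> ('a set \<Rightarrow> real) \<Rightarrow> 'a set \<Rightarrow> real" where
  "coef q V f S = bexp q V (\<lambda>x. f x * chi q S x) / (q * (1 - q)) ^ card S"

lemma chi_insert_point: "i \<notin> S \<Longrightarrow> chi t S (insert i x) = chi t S x"
  unfolding chi_def by (intro prod.cong) auto

lemma chi_insert:
  "finite S \<Longrightarrow> i \<notin> S \<Longrightarrow> chi t (insert i S) x = (of_bool (i \<in> x) - t) * chi t S x"
  unfolding chi_def by simp

lemma four_insert:
  assumes "finite V" "i \<notin> V"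
  shows "four t (insert i V) a x
    = four t V a x + (of_bool (i \<in> x) - t) * four t V (\<lambda>S. a (insert i S)) x"
proof -
  have "a (insert i S) * chi t (insert i S) x
      = (of_bool (i \<in> x) - t) * (a (insert i S) * chi t S x)" if "S \<in> Pow V" for S
    using that assms finite_subset by (subst chi_insert) auto
  then show ?thesis
    unfolding four_def sum_Pow_insert[OF assms] sum_distrib_left
    by (intro arg_cong2[where f = "(+)"] sum.cong refl)
qed

lemma four_insert_point: "i \<notin> V \<Longrightarrow> four t V a (insert i x) = four t V a x"
  unfolding four_def by (intro sum.cong refl arg_cong2[where f = "(*)"] chi_insert_point) auto

lemma four_add: "four t V (\<lambda>S. a S + b S) x = four t V a x + four t V b x"
  by (simp add: four_def algebra_simps sum.distrib)

lemma four_diff: "four t V (\<lambda>S. a S - b S) x = four t V a x - four t V b x"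
  by (simp add: four_def algebra_simps sum_subtractf)

lemma four_cmult: "four t V (\<lambda>S. c * a S) x = c * four t V a x"
  by (simp add: four_def algebra_simps sum_distrib_left)

lemma four_cong: "(\<And>S. S \<subseteq> V \<Longrightarrow> a S = b S) \<Longrightarrow> four t V a x = four t V b x"
  by (simp add: four_def)

lemma coef_insert_out:
  assumes "finite V" "i \<notin> V" "S \<subseteq> V"
  shows "coef q (insert i V) f S
    = q * coef q V (\<lambda>x. f (insert i x)) S + (1 - q) * coef q V f S"
proof -
  have "i \<notin> S" using assms by auto
  then show ?thesis
    using assms unfolding coef_def
    by (simp add: bexp_insert chi_insert_point add_divide_distrib)
qed

text \<open>The new factor of the character is \<open>1 - q\<close> with probability
  \<open>q\<close> and \<open>- q\<close> with probability \<open>1 - q\<close>. Both cases produce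
  \<open>q * (1 - q)\<close> up to sign, which cancels the extra factor of the denominator.\<close>

lemma coef_insert_in:
  assumes "finite V" "i \<notin> V" "S \<subseteq> V" "0 < q" "q < 1"
  shows "coef q (insert i V) f (insert i S) = coef q V (\<lambda>x. f (insert i x)) S - coef q V f S"
proof -
  have S: "i \<notin> S" "finite S" using assms finite_subset by auto
  have 1: "bexp q V (\<lambda>x. f (insert i x) * chi q (insert i S) (insert i x))
      = (1 - q) * bexp q V (\<lambda>x. f (insert i x) * chi q S x)"
    using S unfolding bexp_cmult[symmetric]
    by (intro bexp_cong) (simp add: chi_insert chi_insert_point)
  have 2: "bexp q V (\<lambda>x. f x * chi q (insert i S) x) = (- q) * bexp q V (\<lambda>x. f x * chi q S x)"
    using S assms(2) unfolding bexp_cmult[symmetric]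
    by (intro bexp_cong) (auto simp: chi_insert)
  have 3: "(q * ((1 - q) * x) + (1 - q) * (- q * y)) / (q * (1 - q) * z) = x / z - y / z"
    for x y z
  proof -
    have "q * ((1 - q) * x) + (1 - q) * (- q * y) = (q * (1 - q)) * (x - y)"
      by (simp add: algebra_simps)
    then show ?thesis using assms by (simp add: diff_divide_distrib)
  qed
  show ?thesis
    using S unfolding coef_def bexp_insert[OF assms(1,2)] 1 2 card_insert_disjoint[OF S(2,1)]
      power_Suc by (rule_tac 3)
qed

text \<open>By the two preceding lemmas, coefficients without \<open>i\<close> belong to the average
  of the two sections and coefficients with \<open>i\<close> to their difference. The affine
  function of the bit \<open>i\<close> built from these takes the right value at 0 and at 1.\<close>

lemma four_coef:
  assumes "finite V" "x \<subseteq> V" "0 < q" "q < 1"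
  shows "four q V (coef q V f) x = f x"
  using assms(1,2)
proof (induction V arbitrary: f x rule: finite_induct)
  case empty
  then show ?case by (simp add: four_def coef_def chi_def)
next
  case (insert i V)
  define y where "y = x - {i}"
  have y: "y \<subseteq> V" "i \<notin> y" using insert unfolding y_def by auto
  have xy: "x = (if i \<in> x then insert i y else y)" unfolding y_def by auto
  have f4: "four q V a x = four q V a y" for a
    using xy insert.hyps by (metis four_insert_point)
  have out: "four q V (coef q (insert i V) f) y = q * f (insert i y) + (1 - q) * f y"
  proof -
    have "four q V (coef q (insert i V) f) y
      = four q V (\<lambda>S. q * coef q V (\<lambda>x. f (insert i x)) S + (1 - q) * coef q V f S) y"
      using insert.hyps by (intro four_cong coef_insert_out)
    then show ?thesis using insert.IH[OF y(1)] by (simp add: four_add four_cmult)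
  qed
  have ins: "four q V (\<lambda>S. coef q (insert i V) f (insert i S)) y = f (insert i y) - f y"
  proof -
    have "four q V (\<lambda>S. coef q (insert i V) f (insert i S)) y
      = four q V (\<lambda>S. coef q V (\<lambda>x. f (insert i x)) S - coef q V f S) y"
      using insert.hyps assms by (intro four_cong coef_insert_in)
    then show ?thesis using insert.IH[OF y(1)] by (simp add: four_diff)
  qed
  show ?case
    unfolding four_insert[OF insert.hyps] f4 out ins
  proof (cases "i \<in> x")
    case True
    then have "x = insert i y" using xy by simp
    then show "q * f (insert i y) + (1 - q) * f y + (of_bool (i \<in> x) - q) * (f (insert i y) - f y)
        = f x"
      by (simp add: algebra_simps)
  next
    case False
    then have "x = y" using xy by simp
    with False show "q * f (insert i y) + (1 - q) * f y
        + (of_bool (i \<in> x) - q) * (f (insert i y) - f y) = f x"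
      by (simp add: algebra_simps)
  qed
qed

text \<open>Parseval's identity. Split off one coordinate: its centred bit has mean 0, so the cross
  term \<open>A x * B x\<close> cancels, and variance \<open>t * (1 - t)\<close>, which is the
  coefficient of \<open>(B x)\<^sup>2\<close>.\<close>

lemma bexp_four_square:
  assumes "finite V"
  shows "bexp t V (\<lambda>x. (four t V a x)\<^sup>2) = (\<Sum>S\<in>Pow V. (a S)\<^sup>2 * (t * (1 - t)) ^ card S)"
  using assms
proof (induction V arbitrary: a rule: finite_induct)
  case empty
  then show ?case by (simp add: four_def chi_def)
next
  case (insert i V)
  define A where "A = four t V a"
  define B where "B = four t V (\<lambda>S. a (insert i S))"
  have 1: "four t (insert i V) a (insert i x) = A x + (1 - t) * B x"
    and 0: "x \<subseteq> V \<Longrightarrow> four t (insert i V) a x = A x - t * B x" for x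
    unfolding A_def B_def four_insert[OF insert.hyps] using insert.hyps
    by (auto simp: four_insert_point)
  have "bexp t (insert i V) (\<lambda>x. (four t (insert i V) a x)\<^sup>2)
      = t * bexp t V (\<lambda>x. (A x + (1 - t) * B x)\<^sup>2) + (1 - t) * bexp t V (\<lambda>x. (A x - t * B x)\<^sup>2)"
    unfolding bexp_insert[OF insert.hyps]
    by (intro arg_cong2[where f = "(+)"] arg_cong2[where f = "(*)"] refl bexp_cong)
      (simp_all add: 0 1)
  also have "\<dots> = bexp t V (\<lambda>x. t * (A x + (1 - t) * B x)\<^sup>2 + (1 - t) * (A x - t * B x)\<^sup>2)"
    by (simp add: bexp_add bexp_cmult)
  also have "\<dots> = bexp t V (\<lambda>x. (A x)\<^sup>2 + t * (1 - t) * (B x)\<^sup>2)"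
    by (intro bexp_cong) (simp add: power2_eq_square algebra_simps)
  also have "\<dots> = bexp t V (\<lambda>x. (A x)\<^sup>2) + t * (1 - t) * bexp t V (\<lambda>x. (B x)\<^sup>2)"
    by (simp add: bexp_add bexp_cmult)
  also have "\<dots> = (\<Sum>S\<in>Pow V. (a S)\<^sup>2 * (t * (1 - t)) ^ card S)
      + t * (1 - t) * (\<Sum>S\<in>Pow V. (a (insert i S))\<^sup>2 * (t * (1 - t)) ^ card S)"
    unfolding A_def B_def insert.IH ..
  also have "\<dots> = (\<Sum>S\<in>Pow (insert i V). (a S)\<^sup>2 * (t * (1 - t)) ^ card S)"
  proof -
    have "(a (insert i S))\<^sup>2 * (t * (1 - t)) ^ card (insert i S)
        = t * (1 - t) * ((a (insert i S))\<^sup>2 * (t * (1 - t)) ^ card S)" if "S \<in> Pow V" for S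
    proof -
      have "finite S" "i \<notin> S" using that insert.hyps finite_subset by auto
      then show ?thesis by simp
    qed
    then show ?thesis
      unfolding sum_Pow_insert[OF insert.hyps] sum_distrib_left
      by (intro arg_cong2[where f = "(+)"] sum.cong refl) (rule sym)
  qed
  finally show ?case .
qed

text \<open>The bits of a thinning of \<open>y\<close> are independent with means
  \<open>u * of_bool (i \<in> y)\<close>; an element of \<open>S\<close> outside \<open>y\<close>
  contributes the factor \<open>- q\<close>.\<close>

lemma bexp_chi:
  assumes "finite y" "finite S"
  shows "bexp u y (chi q S) = (\<Prod>i\<in>S. u * of_bool (i \<in> y) - q)"
  using assms
proof (induction y arbitrary: S rule: finite_induct)
  case empty
  then show ?case by (simp add: chi_def)
next
  case (insert j y)
  show ?case
  proof (cases "j \<in> S")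
    case False
    then have eq: "(\<Prod>i\<in>S. u * of_bool (i \<in> insert j y) - q) = (\<Prod>i\<in>S. u * of_bool (i \<in> y) - q)"
      by (intro prod.cong) auto
    then show ?thesis
      using insert.IH[OF insert.prems] False
      unfolding bexp_insert[OF insert.hyps] eq
      by (simp add: chi_insert_point algebra_simps)
  next
    case True
    define T where "T = S - {j}"
    have T: "S = insert j T" "j \<notin> T" "finite T" using True insert.prems unfolding T_def by auto
    have "(\<Prod>i\<in>T. u * of_bool (i \<in> insert j y) - q) = (\<Prod>i\<in>T. u * of_bool (i \<in> y) - q)"
      using T by (intro prod.cong) auto
    also have "\<dots> = bexp u y (chi q T)" using insert.IH T by simp
    finally have R: "(\<Prod>i\<in>S. u * of_bool (i \<in> insert j y) - q) = (u - q) * bexp u y (chi q T)"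
      unfolding T(1) using T(2,3) by simp
    have 1: "bexp u y (\<lambda>x. chi q S (insert j x)) = (1 - q) * bexp u y (chi q T)"
      unfolding T(1) bexp_cmult[symmetric] using T
      by (intro bexp_cong) (simp add: chi_insert chi_insert_point)
    have 0: "bexp u y (chi q S) = (- q) * bexp u y (chi q T)"
      unfolding T(1) bexp_cmult[symmetric] using T insert.hyps
      by (intro bexp_cong) (auto simp: chi_insert)
    show ?thesis
      unfolding R bexp_insert[OF insert.hyps] 0 1 by (simp add: algebra_simps)
  qed
qed

text \<open>Since \<open>q = u * t\<close>, each factor in \<open>bexp_chi\<close> is
  \<open>u\<close> times a centred \<open>t\<close>-biased bit. Thinning therefore turns
  \<open>q\<close>-characters into \<open>t\<close>-characters and damps degree \<open>k\<close> by
  \<open>u ^ k\<close>.\<close>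

lemma bexp_four:
  assumes "finite V" "y \<subseteq> V" "q = u * t"
  shows "bexp u y (four q V a) = four t V (\<lambda>S. u ^ card S * a S) y"
proof -
  have chi: "bexp u y (chi q S) = u ^ card S * chi t S y" if "S \<subseteq> V" for S
  proof -
    have "bexp u y (chi q S) = (\<Prod>i\<in>S. u * (of_bool (i \<in> y) - t))"
      using that assms finite_subset by (subst bexp_chi) (auto simp: algebra_simps)
    then show ?thesis unfolding chi_def prod.distrib by simp
  qed
  have "bexp u y (four q V a) = (\<Sum>S\<in>Pow V. a S * bexp u y (chi q S))"
    unfolding four_def bexp_sum bexp_cmult ..
  also have "\<dots> = four t V (\<lambda>S. u ^ card S * a S) y"
    unfolding four_def using chi by (intro sum.cong) auto
  finally show ?thesis .
qed

text \<open>The share of \<open>S\<close> in the second moment of \<open>f\<close> according to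
  Parseval's identity.\<close>

definition wt :: "real \<Rightarrow> 'a set \<Rightarrow> ('a set \<Rightarrow> real) \<Rightarrow> 'a set \<Rightarrow> real" where
  "wt q V f S = (coef q V f S)\<^sup>2 * (q * (1 - q)) ^ card S"

lemma wt_nonneg: "0 \<le> q \<Longrightarrow> q \<le> 1 \<Longrightarrow> 0 \<le> wt q V f S"
  unfolding wt_def by simp

lemma sum_wt:
  assumes "finite V" "0 < q" "q < 1"
  shows "(\<Sum>S\<in>Pow V. wt q V f S) = bexp q V (\<lambda>x. (f x)\<^sup>2)"
  unfolding wt_def bexp_four_square[OF assms(1), symmetric]
  using assms by (intro bexp_cong) (simp add: four_coef)

lemma sum_wt_le_1:
  assumes "finite V" "0 < q" "q < 1" "\<And>x. x \<subseteq> V \<Longrightarrow> f x \<in> {0..1}"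
  shows "(\<Sum>S\<in>Pow V. wt q V f S) \<le> 1"
proof -
  have "bexp q V (\<lambda>x. (f x)\<^sup>2) \<le> bexp q V (\<lambda>_. 1)"
    using assms by (intro bexp_mono) (auto intro: power_le_one)
  then show ?thesis using assms by (simp add: sum_wt bexp_const)
qed

subsection \<open>Evolution of the logarithmic mean\<close>

text \<open>The Russo-Margulis formula for an integrand that itself varies with the bias. The
  induction applies the product rule to the two sections at one coordinate.\<close>

lemma bexp_has_derivative:
  assumes "finite V" "\<And>y. y \<subseteq> V \<Longrightarrow> ((\<lambda>s. G s y) has_real_derivative G' y) (at t)"
  shows "((\<lambda>s. bexp s V (G s)) has_real_derivative
    (\<Sum>i\<in>V. bexp t (V - {i}) (\<lambda>x. G t (insert i x) - G t x)) + bexp t V G') (at t)"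
  using assms
proof (induction V arbitrary: G G' rule: finite_induct)
  case (insert j V)
  define D where "D g = (\<Sum>i\<in>V. bexp t (V - {i}) (\<lambda>x. g (insert i x) - g x))"
    for g :: "'a set \<Rightarrow> real"
  define G1 where "G1 s x = G s (insert j x)" for s x
  define G1' where "G1' x = G' (insert j x)" for x
  have 1: "((\<lambda>s. bexp s V (G1 s)) has_real_derivative D (G1 t) + bexp t V G1') (at t)"
    unfolding D_def G1_def G1'_def by (intro insert.IH insert.prems) auto
  have 0: "((\<lambda>s. bexp s V (G s)) has_real_derivative D (G t) + bexp t V G') (at t)"
    unfolding D_def by (rule insert.IH) (use insert.prems in auto)
  have eq: "bexp s (insert j V) (G s) = s * bexp s V (G1 s) + (1 - s) * bexp s V (G s)" for s
    unfolding G1_def by (rule bexp_insert[OF insert.hyps])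
  have D: "(\<Sum>i\<in>insert j V. bexp t (insert j V - {i}) (\<lambda>x. G t (insert i x) - G t x))
      = (bexp t V (G1 t) - bexp t V (G t)) + (t * D (G1 t) + (1 - t) * D (G t))"
  proof -
    have "bexp t (insert j V - {i}) (\<lambda>x. G t (insert i x) - G t x)
      = t * bexp t (V - {i}) (\<lambda>x. G1 t (insert i x) - G1 t x)
        + (1 - t) * bexp t (V - {i}) (\<lambda>x. G t (insert i x) - G t x)" if "i \<in> V" for i
    proof -
      have "insert j V - {i} = insert j (V - {i})" "j \<notin> V - {i}" "finite (V - {i})"
        using that insert.hyps by auto
      then show ?thesis unfolding G1_def by (simp add: bexp_insert insert_commute)
    qed
    moreover have "insert j V - {j} = V" using insert.hyps by auto
    ultimately show ?thesis
      using insert.hyps unfolding D_def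
      by (simp add: bexp_diff G1_def[abs_def] sum.distrib sum_distrib_left)
  qed
  have G': "bexp t (insert j V) G' = t * bexp t V G1' + (1 - t) * bexp t V G'"
    unfolding G1'_def by (rule bexp_insert[OF insert.hyps])
  show ?case
    unfolding eq D G'
    by (rule DERIV_cong[OF DERIV_add[OF DERIV_mult[OF DERIV_ident 1]
          DERIV_mult[OF DERIV_diff[OF DERIV_const DERIV_ident] 0]]])
      (simp add: algebra_simps)
qed simp

text \<open>An element \<open>i\<close> belongs to \<open>y\<close> with probability
  \<open>t\<close>, and then the rest of \<open>y\<close> is a \<open>t\<close>-random subset of
  \<open>V - {i}\<close>. This brings derivatives of thinnings to the same shape as the
  Russo-Margulis sum.\<close>

lemma bexp_sum_elements:
  assumes "finite V"
  shows "bexp t V (\<lambda>y. \<Sum>i\<in>y. h i y) = t * (\<Sum>i\<in>V. bexp t (V - {i}) (\<lambda>x. h i (insert i x)))"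
proof -
  have "bexp t V (\<lambda>y. \<Sum>i\<in>y. h i y) = bexp t V (\<lambda>y. \<Sum>i\<in>V. of_bool (i \<in> y) * h i y)"
  proof (intro bexp_cong)
    fix y assume "y \<subseteq> V"
    then have "(\<Sum>i\<in>V. of_bool (i \<in> y) * h i y) = (\<Sum>i\<in>y. of_bool (i \<in> y) * h i y)"
      using assms by (intro sum.mono_neutral_right) auto
    then show "(\<Sum>i\<in>y. h i y) = (\<Sum>i\<in>V. of_bool (i \<in> y) * h i y)" by simp
  qed
  also have "\<dots> = (\<Sum>i\<in>V. bexp t V (\<lambda>y. of_bool (i \<in> y) * h i y))"
    by (rule bexp_sum)
  also have "\<dots> = (\<Sum>i\<in>V. t * bexp t (V - {i}) (\<lambda>x. h i (insert i x)))"
  proof (intro sum.cong refl)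
    fix i assume "i \<in> V"
    have "bexp t (V - {i}) (\<lambda>y. of_bool (i \<in> y) * h i y) = bexp t (V - {i}) (\<lambda>y. 0)"
      by (intro bexp_cong) auto
    then show "bexp t V (\<lambda>y. of_bool (i \<in> y) * h i y) = t * bexp t (V - {i}) (\<lambda>x. h i (insert i x))"
      using assms by (simp add: bexp_remove[OF assms \<open>i \<in> V\<close>] bexp_const)
  qed
  finally show ?thesis by (simp add: sum_distrib_left)
qed

text \<open>Induction by the law of total variance: splitting off \<open>j\<close> adds
  \<open>t * (1 - t)\<close> times the squared difference of the means of the two sections, which is
  at most the mean of the squared difference.\<close>

lemma bexp_Poincare:
  assumes "finite V" "0 \<le> t" "t \<le> 1"
  shows "bexp t V (\<lambda>x. (f x)\<^sup>2) - (bexp t V f)\<^sup>2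
    \<le> t * (1 - t) * (\<Sum>i\<in>V. bexp t (V - {i}) (\<lambda>x. (f (insert i x) - f x)\<^sup>2))"
  using assms(1)
proof (induction V arbitrary: f rule: finite_induct)
  case (insert j V)
  define D where "D g = (\<Sum>i\<in>V. bexp t (V - {i}) (\<lambda>x. (g (insert i x) - g x)\<^sup>2))"
    for g :: "'a set \<Rightarrow> real"
  define f1 where "f1 x = f (insert j x)" for x
  have D: "(\<Sum>i\<in>insert j V. bexp t (insert j V - {i}) (\<lambda>x. (f (insert i x) - f x)\<^sup>2))
      = bexp t V (\<lambda>x. (f1 x - f x)\<^sup>2) + (t * D f1 + (1 - t) * D f)"
  proof -
    have "bexp t (insert j V - {i}) (\<lambda>x. (f (insert i x) - f x)\<^sup>2)
      = t * bexp t (V - {i}) (\<lambda>x. (f1 (insert i x) - f1 x)\<^sup>2)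
        + (1 - t) * bexp t (V - {i}) (\<lambda>x. (f (insert i x) - f x)\<^sup>2)" if "i \<in> V" for i
    proof -
      have "insert j V - {i} = insert j (V - {i})" "j \<notin> V - {i}" "finite (V - {i})"
        using that insert.hyps by auto
      then show ?thesis unfolding f1_def by (simp add: bexp_insert insert_commute)
    qed
    moreover have "insert j V - {j} = V" using insert.hyps by auto
    ultimately show ?thesis
      using insert.hyps unfolding D_def
      by (simp add: f1_def sum.distrib sum_distrib_left)
  qed
  have IH: "bexp t V (\<lambda>x. (g x)\<^sup>2) - (bexp t V g)\<^sup>2 \<le> t * (1 - t) * D g" for g
    unfolding D_def by (rule insert.IH)
  have sq: "(bexp t V f1 - bexp t V f)\<^sup>2 \<le> bexp t V (\<lambda>x. (f1 x - f x)\<^sup>2)"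
    using bexp_square_le[OF insert.hyps(1) assms(2,3), of "\<lambda>x. f1 x - f x"]
    by (simp add: bexp_diff)
  have "bexp t (insert j V) (\<lambda>x. (f x)\<^sup>2) - (bexp t (insert j V) f)\<^sup>2
    = t * (bexp t V (\<lambda>x. (f1 x)\<^sup>2) - (bexp t V f1)\<^sup>2)
      + (1 - t) * (bexp t V (\<lambda>x. (f x)\<^sup>2) - (bexp t V f)\<^sup>2)
      + t * (1 - t) * (bexp t V f1 - bexp t V f)\<^sup>2"
    unfolding bexp_insert[OF insert.hyps] f1_def by (simp add: power2_eq_square algebra_simps)
  also have "\<dots> \<le> t * (t * (1 - t) * D f1) + (1 - t) * (t * (1 - t) * D f)
      + t * (1 - t) * bexp t V (\<lambda>x. (f1 x - f x)\<^sup>2)"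
    using assms by (intro add_mono mult_left_mono IH sq) auto
  also have "\<dots> = t * (1 - t) * (bexp t V (\<lambda>x. (f1 x - f x)\<^sup>2) + (t * D f1 + (1 - t) * D f))"
    by (simp add: algebra_simps)
  finally show ?case unfolding D .
qed simp

text \<open>Russo-Margulis and the chain rule for \<open>q / s\<close>. Each term is rewritten by
  deleting \<open>i\<close> from \<open>y\<close>, so that only values of the thinned function
  itself occur.\<close>

lemma bexp_has_derivative_thinning:
  assumes "finite y" "t > 0"
  shows "((\<lambda>s. bexp (q / s) y f) has_real_derivative
    - (\<Sum>i\<in>y. bexp (q / t) y f - bexp (q / t) (y - {i}) f) / t) (at t)"
proof -
  define u where "u = q / t"
  define D where "D = (\<Sum>i\<in>y. bexp u (y - {i}) (\<lambda>x. f (insert i x) - f x))"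
  have "((\<lambda>s. bexp s y f) has_real_derivative D) (at u)"
    unfolding D_def using bexp_has_derivative[of y "\<lambda>_. f" "\<lambda>_. 0" u] assms
    by (simp add: bexp_const)
  moreover have "((\<lambda>s. q / s) has_real_derivative - (q / t\<^sup>2)) (at t)"
    using assms by (auto intro!: derivative_eq_intros simp: power2_eq_square divide_simps)
  ultimately have d: "((\<lambda>s. bexp (q / s) y f) has_real_derivative D * - (q / t\<^sup>2)) (at t)"
    unfolding u_def by (rule DERIV_chain2)
  have "bexp u y f - bexp u (y - {i}) f = u * bexp u (y - {i}) (\<lambda>x. f (insert i x) - f x)"
    if "i \<in> y" for i
    unfolding bexp_remove[OF assms(1) that] bexp_diff by (simp add: algebra_simps)
  then have "(\<Sum>i\<in>y. bexp u y f - bexp u (y - {i}) f) = u * D"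
    unfolding D_def sum_distrib_left by (rule sum.cong[OF refl])
  then have "- (\<Sum>i\<in>y. bexp u y f - bexp u (y - {i}) f) / t = D * - (q / t\<^sup>2)"
    unfolding u_def by (simp add: power2_eq_square)
  with d show ?thesis unfolding u_def by simp
qed

text \<open>For \<open>v \<ge> 0\<close> this follows from the Taylor bound. On [-1, 0] the
  difference of the two sides decreases to 0, because
  \<open>exp x \<le> 1 / (1 - x) \<le> 1 + x / 2\<close> there.\<close>

lemma exp_minus_linear_ge:
  fixes v :: real
  assumes "v \<ge> -1"
  shows "exp v - 1 - v \<ge> v\<^sup>2 / 4"
proof (cases "v \<ge> 0")
  case True
  then show ?thesis using exp_lower_Taylor_quadratic[of v] zero_le_power2[of v] by linarith
next
  case False
  define g where "g x = exp x - 1 - x - x\<^sup>2 / 4" for x :: real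
  have 1: "exp x - 1 - x / 2 \<le> 0" if "-1 \<le> x" "x \<le> 0" for x :: real
  proof -
    have "exp x * exp (- x) = 1" by (simp flip: exp_add)
    moreover have "exp (- x) \<ge> 1 - x" using exp_ge_add_one_self[of "-x"] by simp
    ultimately have "exp x * (1 - x) \<le> 1"
      by (metis exp_ge_zero mult_left_mono)
    then have "exp x \<le> 1 / (1 - x)" using that by (simp add: field_simps)
    also have "\<dots> \<le> 1 + x / 2"
    proof -
      have "x * (1 + x) \<le> 0" using that by (simp add: mult_le_0_iff)
      then have "1 \<le> (1 + x / 2) * (1 - x)"
        using that by (simp add: algebra_simps)
      then show ?thesis using that by (simp add: divide_simps)
    qed
    finally show ?thesis by simp
  qed
  have "g 0 \<le> g v"
  proof (rule DERIV_nonpos_imp_nonincreasing[of v 0])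
    fix x assume x: "v \<le> x" "x \<le> 0"
    have "(g has_real_derivative exp x - 1 - x / 2) (at x)"
      unfolding g_def by (auto intro!: derivative_eq_intros)
    then show "\<exists>y. (g has_real_derivative y) (at x) \<and> y \<le> 0"
      using 1[of x] x assms by (metis order_trans)
  qed (use False in auto)
  then show ?thesis unfolding g_def by simp
qed

text \<open>With \<open>v = ln b - ln a\<close> the left side is \<open>exp v - 1 - v\<close>. If
  \<open>a - b < \<eta> / 2\<close>, then \<open>b > a / 2\<close> because
  \<open>a \<ge> \<eta>\<close>, hence \<open>v \<ge> -1\<close> and the quadratic bound applies.
  Otherwise the right side is at most 0, since both logarithms lie in an interval of length
  \<open>ln ((1 + \<eta>) / \<eta>)\<close>.\<close>

lemma ln_Bregman_ge:
  fixes a b \<eta> :: real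
  assumes "0 < \<eta>" "a \<in> {\<eta>..1 + \<eta>}" "b \<in> {\<eta>..1 + \<eta>}"
  shows "ln a - ln b - (a - b) / a
    \<ge> (ln a - ln b)\<^sup>2 / 4 - (ln ((1 + \<eta>) / \<eta>))\<^sup>2 / 4 * of_bool (a - b \<ge> \<eta> / 2)"
proof -
  define v where "v = ln b - ln a"
  have pos: "a > 0" "b > 0" using assms by auto
  have "exp v = exp (ln b) / exp (ln a)" unfolding v_def by (rule exp_diff)
  then have ev: "exp v = b / a" using pos by simp
  have eq: "ln a - ln b - (a - b) / a = exp v - 1 - v"
    unfolding ev using pos by (simp add: v_def field_simps)
  have sq: "(ln a - ln b)\<^sup>2 = v\<^sup>2" unfolding v_def by (simp add: power2_commute)
  have "0 \<le> exp v - 1 - v" using exp_ge_add_one_self[of v] by linarith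
  moreover have "v\<^sup>2 \<le> (ln ((1 + \<eta>) / \<eta>))\<^sup>2"
  proof -
    have "ln \<eta> \<le> ln a" "ln \<eta> \<le> ln b" "ln a \<le> ln (1 + \<eta>)" "ln b \<le> ln (1 + \<eta>)"
      using assms pos by auto
    moreover have "ln ((1 + \<eta>) / \<eta>) = ln (1 + \<eta>) - ln \<eta>"
      using assms by (simp add: ln_div)
    ultimately have "\<bar>v\<bar> \<le> \<bar>ln ((1 + \<eta>) / \<eta>)\<bar>" unfolding v_def by linarith
    then show ?thesis by (simp add: abs_le_square_iff)
  qed
  moreover have "v\<^sup>2 / 4 \<le> exp v - 1 - v" if "\<not> a - b \<ge> \<eta> / 2"
  proof (rule exp_minus_linear_ge, rule ccontr)
    assume "\<not> -1 \<le> v"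
    then have "exp v \<le> exp (-1)" by simp
    also have "\<dots> \<le> 1 / 2" using exp_ge_add_one_self[of 1] by (simp add: exp_minus field_simps)
    finally have "b \<le> a / 2" unfolding ev using pos by (simp add: field_simps)
    then show False using that assms by auto
  qed
  ultimately show ?thesis unfolding eq sq by (cases "a - b \<ge> \<eta> / 2") auto
qed

section \<open>The differential inequality for the logarithmic mean\<close>

lemma bexp_variance:
  assumes "finite V"
  shows "bexp t V (\<lambda>x. (f x - bexp t V f)\<^sup>2) = bexp t V (\<lambda>x. (f x)\<^sup>2) - (bexp t V f)\<^sup>2"
proof -
  define m where "m = bexp t V f"
  have "bexp t V (\<lambda>x. (f x - m)\<^sup>2) = bexp t V (\<lambda>x. ((f x)\<^sup>2 - (2 * m) * f x) + m\<^sup>2)"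
    by (intro bexp_cong) (simp add: power2_eq_square algebra_simps)
  also have "\<dots> = bexp t V (\<lambda>x. (f x)\<^sup>2) - 2 * m * m + m\<^sup>2"
    unfolding bexp_add bexp_diff bexp_cmult using assms by (simp add: bexp_const m_def)
  finally show ?thesis unfolding m_def[symmetric] by (simp add: power2_eq_square)
qed

text \<open>The bound does not depend on \<open>\<eta>\<close>: if \<open>u = ln (\<kappa> / 2) - m\<close> is large, then \<open>1 / u\<close> grows linearly.\<close>

lemma bexp_ln_thinning_ge:
  fixes f :: "'a set \<Rightarrow> real"
  assumes V: "finite V"
    and q: "0 < q" "q \<le> t0" "t0 < p" "p < 1"
    and \<eta>: "0 < \<eta>"
    and f: "\<And>x. x \<subseteq> V \<Longrightarrow> f x \<in> {0..1}"
    and \<kappa>: "0 < \<kappa>" "\<kappa> \<le> bexp q V f"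
    and jumps: "\<And>t. t \<in> {t0..p} \<Longrightarrow>
      (ln ((1 + \<eta>) / \<eta>))\<^sup>2 * (\<Sum>i\<in>V. bexp t (V - {i}) (\<lambda>x.
        of_bool (bexp (q / t) (insert i x) f - bexp (q / t) x f \<ge> \<eta> / 2))) \<le> 4"
  shows "bexp p V (\<lambda>y. ln (bexp (q / p) y f + \<eta>)) \<ge> ln (\<kappa> / 2) - 4 / (\<kappa> * (p - t0))"
proof -
  define F where "F t y = bexp (q / t) y f" for t y
  define L where "L t y = ln (F t y + \<eta>)" for t y
  define m where "m t = bexp t V (L t)" for t
  \<comment> \<open>The increment of \<open>L\<close> minus its linearisation at the larger set; it
    is nonnegative by concavity of \<open>ln\<close>.\<close>
  define R where "R t i x = L t (insert i x) - L t x
      - (F t (insert i x) - F t x) / (F t (insert i x) + \<eta>)" for t i x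
  define m' where "m' t = (\<Sum>i\<in>V. bexp t (V - {i}) (R t i))" for t
  define S where "S t = (\<Sum>i\<in>V. bexp t (V - {i}) (\<lambda>x. (L t (insert i x) - L t x)\<^sup>2))" for t
  have t01: "0 < t" "t < 1" "0 \<le> q / t" "q / t \<le> 1" if "t \<in> {t0..p}" for t
    using that q by auto
  have F01: "0 \<le> F t y" "F t y \<le> 1" if "t \<in> {t0..p}" "y \<subseteq> V" for t y
    using bexp_in_01[of y "q / t" f] t01[OF that(1)] that(2) V f
    unfolding F_def by (auto intro: finite_subset)
  have ins: "insert i x \<subseteq> V" "x \<subseteq> V" if "i \<in> V" "x \<subseteq> V - {i}" for i x
    using that by auto
  have deriv: "(m has_real_derivative m' t) (at t)" if t: "t \<in> {t0..p}" for t
  proof -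
    \<comment> \<open>The derivative of \<open>L\<close> at a fixed \<open>y\<close>. In
      \<open>m'\<close> it supplies the linear terms of \<open>R\<close>, while the moving bias
      supplies the increments of \<open>L\<close>.\<close>
    define L' where "L' y = - ((\<Sum>i\<in>y. (F t y - F t (y - {i})) / (F t y + \<eta>)) / t)" for y
    have "((\<lambda>s. L s y) has_real_derivative L' y) (at t)" if y: "y \<subseteq> V" for y
    proof -
      have "((\<lambda>s. F s y) has_real_derivative - (\<Sum>i\<in>y. F t y - F t (y - {i})) / t) (at t)"
        unfolding F_def by (intro bexp_has_derivative_thinning finite_subset[OF y V] t01 t)
      moreover have "F t y + \<eta> > 0" using F01[OF t y] \<eta> by simp
      ultimately have "((\<lambda>s. ln (F s y + \<eta>)) has_real_derivative
          (- (\<Sum>i\<in>y. F t y - F t (y - {i})) / t) / (F t y + \<eta>)) (at t)"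
        by (auto intro!: derivative_eq_intros)
      then show ?thesis
        unfolding L_def L'_def by (simp add: sum_divide_distrib[symmetric] mult.commute)
    qed
    then have d: "(m has_real_derivative
        (\<Sum>i\<in>V. bexp t (V - {i}) (\<lambda>x. L t (insert i x) - L t x)) + bexp t V L') (at t)"
      unfolding m_def by (rule bexp_has_derivative[OF V])
    have "bexp t V L' = - (bexp t V (\<lambda>y. \<Sum>i\<in>y. (F t y - F t (y - {i})) / (F t y + \<eta>)) / t)"
      unfolding L'_def bexp_minus bexp_divide ..
    also have "\<dots> = - (\<Sum>i\<in>V. bexp t (V - {i})
        (\<lambda>x. (F t (insert i x) - F t (insert i x - {i})) / (F t (insert i x) + \<eta>)))"
      unfolding bexp_sum_elements[OF V] using t01[OF t] by simp
    also have "\<dots> = - (\<Sum>i\<in>V. bexp t (V - {i})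
        (\<lambda>x. (F t (insert i x) - F t x) / (F t (insert i x) + \<eta>)))"
    proof (intro arg_cong[where f = uminus] sum.cong refl bexp_cong)
      fix i x assume "i \<in> V" "x \<subseteq> V - {i}"
      then have "insert i x - {i} = x" by auto
      then show "(F t (insert i x) - F t (insert i x - {i})) / (F t (insert i x) + \<eta>)
        = (F t (insert i x) - F t x) / (F t (insert i x) + \<eta>)" by simp
    qed
    finally show ?thesis
      using d unfolding m'_def R_def bexp_diff sum_subtractf by simp
  qed
  have m'_nonneg: "m' t \<ge> 0" if t: "t \<in> {t0..p}" for t
    unfolding m'_def
  proof (intro sum_nonneg bexp_nonneg)
    fix i x assume i: "i \<in> V" "x \<subseteq> V - {i}"
    have "F t x + \<eta> > 0" "F t (insert i x) + \<eta> > 0"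
      using F01[OF t ins(1)[OF i]] F01[OF t ins(2)[OF i]] \<eta> by auto
    from ln_diff_le[OF this] show "R t i x \<ge> 0"
      unfolding R_def L_def by (simp add: diff_divide_distrib)
  qed (use t01[OF t] in auto)
  have m'_ge_S: "m' t \<ge> S t / 4 - 1" if t: "t \<in> {t0..p}" for t
  proof -
    define \<Lambda> where "\<Lambda> = (ln ((1 + \<eta>) / \<eta>))\<^sup>2"
    define E where "E = (\<Sum>i\<in>V. bexp t (V - {i}) (\<lambda>x.
        of_bool (F t (insert i x) - F t x \<ge> \<eta> / 2)))"
    have "(\<Sum>i\<in>V. bexp t (V - {i}) (\<lambda>x. (L t (insert i x) - L t x)\<^sup>2 / 4
        - \<Lambda> / 4 * of_bool (F t (insert i x) - F t x \<ge> \<eta> / 2))) \<le> m' t"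
      unfolding m'_def
    proof (intro sum_mono bexp_mono)
      fix i x assume i: "i \<in> V" "x \<subseteq> V - {i}"
      have "F t x + \<eta> \<in> {\<eta>..1 + \<eta>}" "F t (insert i x) + \<eta> \<in> {\<eta>..1 + \<eta>}"
        using F01[OF t ins(1)[OF i]] F01[OF t ins(2)[OF i]] by auto
      from ln_Bregman_ge[OF \<eta> this(2,1)]
      show "(L t (insert i x) - L t x)\<^sup>2 / 4
          - \<Lambda> / 4 * of_bool (F t (insert i x) - F t x \<ge> \<eta> / 2) \<le> R t i x"
        unfolding R_def L_def \<Lambda>_def by simp
    qed (use t01[OF t] in auto)
    then have "S t / 4 - \<Lambda> / 4 * E \<le> m' t"
      unfolding S_def E_def bexp_diff bexp_divide bexp_cmult sum_subtractf
      by (simp add: sum_divide_distrib sum_distrib_left)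
    moreover have "\<Lambda> * E \<le> 4" using jumps[OF t] unfolding \<Lambda>_def E_def F_def .
    ultimately show ?thesis by simp
  qed
  have mean: "bexp t V (F t) \<ge> \<kappa>" if t: "t \<in> {t0..p}" for t
    unfolding F_def bexp_tower[OF V] using t01[OF t] \<kappa> by simp
  have m'_ge: "m' t \<ge> \<kappa> / 2 * (ln (\<kappa> / 2) - m t)\<^sup>2 - 1"
    if t: "t \<in> {t0..p}" and mt: "m t \<le> ln (\<kappa> / 2)" for t
  proof -
    define D where "D = (ln (\<kappa> / 2) - m t)\<^sup>2"
    \<comment> \<open>\<open>F t y - \<kappa> / 2\<close> has mean at least
      \<open>\<kappa> / 2\<close> and is at most the indicator of
      \<open>F t y \<ge> \<kappa> / 2\<close>. On that event
      \<open>L t y \<ge> ln (\<kappa> / 2) \<ge> m t\<close>, so the squared deviation of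
      \<open>L\<close> is at least \<open>D\<close>.\<close>
    have "\<kappa> / 2 \<le> bexp t V (\<lambda>y. F t y - \<kappa> / 2)"
      using mean[OF t] V by (simp add: bexp_diff bexp_const)
    then have "\<kappa> / 2 * D \<le> bexp t V (\<lambda>y. F t y - \<kappa> / 2) * D"
      unfolding D_def by (intro mult_right_mono) auto
    also have "\<dots> = bexp t V (\<lambda>y. D * (F t y - \<kappa> / 2))"
      by (simp add: bexp_cmult)
    also have "\<dots> \<le> bexp t V (\<lambda>y. (L t y - m t)\<^sup>2)"
    proof (intro bexp_mono)
      fix y assume y: "y \<subseteq> V"
      show "D * (F t y - \<kappa> / 2) \<le> (L t y - m t)\<^sup>2"
      proof (cases "F t y \<ge> \<kappa> / 2")
        case True
        then have "ln (\<kappa> / 2) \<le> L t y" unfolding L_def using \<kappa> \<eta> by simp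
        then have "D \<le> (L t y - m t)\<^sup>2" unfolding D_def using mt by (intro power_mono) auto
        moreover have "D * (F t y - \<kappa> / 2) \<le> D * 1"
          using F01[OF t y] \<kappa> unfolding D_def by (intro mult_left_mono) auto
        ultimately show ?thesis by simp
      next
        case False
        then have "D * (F t y - \<kappa> / 2) \<le> 0" unfolding D_def by (simp add: mult_nonneg_nonpos)
        then show ?thesis by (smt (verit) zero_le_power2)
      qed
    qed (use t01[OF t] in auto)
    also have "\<dots> = bexp t V (\<lambda>y. (L t y)\<^sup>2) - (bexp t V (L t))\<^sup>2"
      unfolding m_def by (rule bexp_variance[OF V])
    also have "\<dots> \<le> t * (1 - t) * S t"
      unfolding S_def using t01[OF t] by (intro bexp_Poincare V) auto
    also have "\<dots> \<le> 1 / 4 * S t"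
    proof (intro mult_right_mono)
      show "t * (1 - t) \<le> 1 / 4"
        using zero_le_power2[of "t - 1 / 2"] by (simp add: power2_eq_square algebra_simps)
      show "0 \<le> S t" unfolding S_def using t01[OF t] by (intro sum_nonneg bexp_nonneg) auto
    qed
    finally show ?thesis using m'_ge_S[OF t] unfolding D_def by simp
  qed
  \<comment> \<open>\<open>1 / K\<close> is the growth of \<open>1 / u\<close> over [t0, p] at rate
    \<open>\<kappa> / 4\<close>. Also \<open>\<kappa> * K\<^sup>2 \<ge> 4\<close>, so for
    \<open>u > K\<close> half of the quadratic term of \<open>m'_ge\<close> absorbs the
    \<open>- 1\<close>.\<close>
  define K where "K = 4 / (\<kappa> * (p - t0))"
  define u where "u t = ln (\<kappa> / 2) - m t" for t
  have K: "\<kappa> * K\<^sup>2 \<ge> 4" "K > 0"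
  proof -
    have "\<kappa> \<le> 1" using \<kappa>(2) bexp_in_01[of V q f] V q f by auto
    then have "\<kappa> * (p - t0) \<le> \<kappa> * 1" "\<kappa> * (p - t0) > 0" using \<kappa> q by (auto intro: mult_left_mono)
    then have "4 / \<kappa> \<le> K" unfolding K_def using \<kappa> by (intro divide_left_mono) auto
    then have "(4 / \<kappa>)\<^sup>2 \<le> K\<^sup>2" using \<kappa> by (intro power_mono) auto
    then have "\<kappa> * (4 / \<kappa>)\<^sup>2 \<le> \<kappa> * K\<^sup>2" using \<kappa> by (intro mult_left_mono) auto
    moreover have "\<kappa> * (4 / \<kappa>)\<^sup>2 = 16 / \<kappa>" using \<kappa> by (simp add: power2_eq_square)
    moreover have "16 / \<kappa> \<ge> 4" using \<kappa> \<open>\<kappa> \<le> 1\<close> by (simp add: field_simps)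
    ultimately show "\<kappa> * K\<^sup>2 \<ge> 4" by linarith
    show "K > 0" unfolding K_def using \<kappa> q by simp
  qed
  have "u p \<le> K"
  proof (rule ccontr)
    assume up: "\<not> u p \<le> K"
    \<comment> \<open>\<open>m\<close> is nondecreasing, so the assumption at the endpoint
      \<open>p\<close> holds on the whole interval.\<close>
    have uK: "u t > K" if t: "t \<in> {t0..p}" for t
    proof -
      have "m t \<le> m p"
        using t by (intro DERIV_nonneg_imp_nondecreasing[of t p m])
          (auto intro!: exI[of _ "m' _"] deriv m'_nonneg)
      then show ?thesis using up unfolding u_def by simp
    qed
    \<comment> \<open>The derivative \<open>m' / u\<^sup>2\<close> of \<open>1 / u\<close> will be
      at least \<open>\<kappa> / 4\<close>, and \<open>1 / u\<close> starts positive; so it exceeds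
      \<open>1 / K\<close> at \<open>p\<close>, against the assumption
      \<open>u p > K\<close>.\<close>
    have "\<exists>z. z > t0 \<and> z < p \<and>
        inverse (u p) - inverse (u t0) = (p - t0) * (m' z / (u z)\<^sup>2)"
    proof (rule MVT2[OF q(3)])
      fix t assume "t0 \<le> t" "t \<le> p"
      then have t: "t \<in> {t0..p}" by simp
      have "(u has_real_derivative - m' t) (at t)"
        unfolding u_def by (auto intro!: derivative_eq_intros deriv[OF t])
      moreover have "u t \<noteq> 0" using uK[OF t] K by simp
      ultimately show "((\<lambda>t. inverse (u t)) has_real_derivative m' t / (u t)\<^sup>2) (at t)"
        by (auto intro!: derivative_eq_intros simp: power2_eq_square divide_simps)
    qed
    then obtain z where "z > t0" "z < p"
      and eq: "inverse (u p) - inverse (u t0) = (p - t0) * (m' z / (u z)\<^sup>2)" by blast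
    then have z: "z \<in> {t0..p}" by simp
    have "K\<^sup>2 \<le> (u z)\<^sup>2" using uK[OF z] K by (intro power_mono) auto
    then have "\<kappa> * K\<^sup>2 \<le> \<kappa> * (u z)\<^sup>2" using \<kappa> by (intro mult_left_mono) auto
    then have "1 \<le> \<kappa> / 4 * (u z)\<^sup>2" using K by simp
    moreover have "m' z \<ge> \<kappa> / 2 * (u z)\<^sup>2 - 1"
      using m'_ge[OF z] uK[OF z] K unfolding u_def by simp
    ultimately have "m' z \<ge> \<kappa> / 4 * (u z)\<^sup>2" by simp
    moreover have "(u z)\<^sup>2 > 0" using uK[OF z] K by simp
    ultimately have "\<kappa> / 4 \<le> m' z / (u z)\<^sup>2" by (simp add: field_simps)
    then have "(p - t0) * (\<kappa> / 4) \<le> inverse (u p) - inverse (u t0)"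
      unfolding eq using q by (intro mult_left_mono) auto
    moreover have "inverse (u t0) > 0" using uK[of t0] K q by simp
    moreover have iK: "inverse K = (p - t0) * (\<kappa> / 4)" unfolding K_def by simp
    ultimately have "inverse K < inverse (u p)"
      unfolding iK by linarith
    moreover have "inverse (u p) < inverse K"
      using up K by (intro less_imp_inverse_less) auto
    ultimately show False by simp
  qed
  then show ?thesis unfolding u_def m_def L_def F_def K_def by simp
qed

subsection \<open>Large jumps and influences\<close>

text \<open>
  Bonami's lemma. The weights \<open>C ^ card S\<close> replace a bound on the degree, so that the
  induction over the coordinates needs no bookkeeping of degrees.
\<close>

lemma four_4th_moment:
  assumes "finite V" and t: "0 \<le> t" "t \<le> 1" and C: "C \<ge> 4" "C\<^sup>2 * (t * (1 - t)) \<ge> 3"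
  shows "bexp t V (\<lambda>x. (four t V a x) ^ 4)
    \<le> (\<Sum>S\<in>Pow V. (C * (t * (1 - t))) ^ card S * (a S)\<^sup>2)\<^sup>2"
  using assms(1)
proof (induction V arbitrary: a rule: finite_induct)
  case empty
  then show ?case by (simp add: four_def chi_def)
next
  case (insert i V)
  define s where "s = t * (1 - t)"
  have s: "s \<ge> 0" unfolding s_def using t by simp
  define A where "A = four t V a"
  define B where "B = four t V (\<lambda>S. a (insert i S))"
  define \<alpha> where "\<alpha> = (\<Sum>S\<in>Pow V. (C * s) ^ card S * (a S)\<^sup>2)"
  define \<beta> where "\<beta> = (\<Sum>S\<in>Pow V. (C * s) ^ card S * (a (insert i S))\<^sup>2)"
  have \<alpha>\<beta>: "\<alpha> \<ge> 0" "\<beta> \<ge> 0" unfolding \<alpha>_def \<beta>_def using C s by (auto intro!: sum_nonneg)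
  have A4: "bexp t V (\<lambda>x. A x ^ 4) \<le> \<alpha>\<^sup>2" and B4: "bexp t V (\<lambda>x. B x ^ 4) \<le> \<beta>\<^sup>2"
    unfolding A_def B_def \<alpha>_def \<beta>_def s_def by (rule insert.IH)+
  have 1: "four t (insert i V) a (insert i x) = A x + (1 - t) * B x"
    and 0: "x \<subseteq> V \<Longrightarrow> four t (insert i V) a x = A x - t * B x" for x
    unfolding A_def B_def four_insert[OF insert.hyps] using insert.hyps
    by (auto simp: four_insert_point)
  have AB: "bexp t V (\<lambda>x. (A x)\<^sup>2 * (B x)\<^sup>2) \<le> \<alpha> * \<beta>"
  proof (rule power2_le_imp_le)
    have "(bexp t V (\<lambda>x. (A x)\<^sup>2 * (B x)\<^sup>2))\<^sup>2
        \<le> bexp t V (\<lambda>x. ((A x)\<^sup>2)\<^sup>2) * bexp t V (\<lambda>x. ((B x)\<^sup>2)\<^sup>2)"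
      by (rule bexp_Cauchy_Schwarz[OF t])
    also have "\<dots> = bexp t V (\<lambda>x. A x ^ 4) * bexp t V (\<lambda>x. B x ^ 4)"
      by (simp flip: power_mult)
    also have "\<dots> \<le> \<alpha>\<^sup>2 * \<beta>\<^sup>2"
      using t by (intro mult_mono A4 B4 bexp_nonneg) auto
    finally show "(bexp t V (\<lambda>x. (A x)\<^sup>2 * (B x)\<^sup>2))\<^sup>2 \<le> (\<alpha> * \<beta>)\<^sup>2"
      by (simp add: power_mult_distrib)
  qed (use \<alpha>\<beta> in simp)
  have "bexp t (insert i V) (\<lambda>x. (four t (insert i V) a x) ^ 4)
      = t * bexp t V (\<lambda>x. (A x + (1 - t) * B x) ^ 4) + (1 - t) * bexp t V (\<lambda>x. (A x - t * B x) ^ 4)"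
    unfolding bexp_insert[OF insert.hyps]
    by (intro arg_cong2[where f = "(+)"] arg_cong2[where f = "(*)"] refl bexp_cong)
      (simp_all add: 0 1)
  also have "\<dots> = bexp t V (\<lambda>x. t * (A x + (1 - t) * B x) ^ 4 + (1 - t) * (A x - t * B x) ^ 4)"
    by (simp add: bexp_add bexp_cmult)
  also have "\<dots> \<le> bexp t V (\<lambda>x. A x ^ 4 + 8 * s * ((A x)\<^sup>2 * (B x)\<^sup>2) + 3 * s * B x ^ 4)"
  proof (intro bexp_mono t)
    fix x
    \<comment> \<open>Completing the square absorbs the mixed term
      \<open>4 * s * (1 - 2 * t) * A x * B x ^ 3\<close> and raises the coefficient of
      \<open>(A x)\<^sup>2 * (B x)\<^sup>2\<close> from \<open>6 * s\<close> to
      \<open>8 * s\<close>.\<close>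
    have "A x ^ 4 + 8 * s * ((A x)\<^sup>2 * (B x)\<^sup>2) + 3 * s * B x ^ 4
        = t * (A x + (1 - t) * B x) ^ 4 + (1 - t) * (A x - t * B x) ^ 4
          + (2 * s * (A x * B x - (1 - 2 * t) * (B x)\<^sup>2)\<^sup>2 + 11 * s\<^sup>2 * B x ^ 4)"
      unfolding s_def by algebra
    moreover have "0 \<le> 2 * s * (A x * B x - (1 - 2 * t) * (B x)\<^sup>2)\<^sup>2 + 11 * s\<^sup>2 * B x ^ 4"
      using s by simp
    ultimately show "t * (A x + (1 - t) * B x) ^ 4 + (1 - t) * (A x - t * B x) ^ 4
        \<le> A x ^ 4 + 8 * s * ((A x)\<^sup>2 * (B x)\<^sup>2) + 3 * s * B x ^ 4" by linarith
  qed
  also have "\<dots> = bexp t V (\<lambda>x. A x ^ 4) + 8 * s * bexp t V (\<lambda>x. (A x)\<^sup>2 * (B x)\<^sup>2)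
      + 3 * s * bexp t V (\<lambda>x. B x ^ 4)"
    by (simp only: bexp_add bexp_cmult)
  also have "\<dots> \<le> \<alpha>\<^sup>2 + 8 * s * (\<alpha> * \<beta>) + 3 * s * \<beta>\<^sup>2"
    using s by (intro add_mono mult_left_mono A4 B4 AB) auto
  also have "\<dots> \<le> (\<alpha> + C * s * \<beta>)\<^sup>2"
  proof -
    \<comment> \<open>The two conditions on \<open>C\<close> compare the coefficients 8 and 3 with
      those of the expanded square.\<close>
    have "8 * (s * (\<alpha> * \<beta>)) \<le> 2 * C * (s * (\<alpha> * \<beta>))"
      using C s \<alpha>\<beta> by (intro mult_right_mono) auto
    moreover have "3 * (s * \<beta>\<^sup>2) \<le> C\<^sup>2 * s * (s * \<beta>\<^sup>2)"
      using C s unfolding s_def by (intro mult_right_mono) auto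
    ultimately show ?thesis by (simp add: power2_eq_square algebra_simps)
  qed
  also have "\<alpha> + C * s * \<beta> = (\<Sum>S\<in>Pow (insert i V). (C * s) ^ card S * (a S)\<^sup>2)"
  proof -
    have "C * s * ((C * s) ^ card S * (a (insert i S))\<^sup>2)
        = (C * s) ^ card (insert i S) * (a (insert i S))\<^sup>2" if "S \<in> Pow V" for S
    proof -
      have "finite S" "i \<notin> S" using that insert.hyps finite_subset by auto
      then show ?thesis by simp
    qed
    then show ?thesis
      unfolding \<alpha>_def \<beta>_def sum_Pow_insert[OF insert.hyps] sum_distrib_left
      by (intro arg_cong2[where f = "(+)"] sum.cong refl)
  qed
  finally show ?case unfolding s_def .
qed

section \<open>Low-degree influences\<close>

text \<open>The influence of \<open>i\<close> on the part of degree at most \<open>d\<close>; the summation variable omits \<open>i\<close>.\<close>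

definition infl :: "nat \<Rightarrow> real \<Rightarrow> 'a set \<Rightarrow> ('a set \<Rightarrow> real) \<Rightarrow> 'a \<Rightarrow> real" where
  "infl d q V f i = (\<Sum>S\<in>Pow (V - {i}). of_bool (card S < d) * wt q V f (insert i S))"

lemma sum_Pow_containing:
  fixes g :: "'a set \<Rightarrow> real"
  assumes "finite V" "i \<in> V"
  shows "(\<Sum>S\<in>Pow (V - {i}). g (insert i S)) = (\<Sum>S\<in>Pow V. of_bool (i \<in> S) * g S)"
proof -
  have V: "V = insert i (V - {i})" using assms by auto
  have "(\<Sum>S\<in>Pow V. of_bool (i \<in> S) * g S) = (\<Sum>S\<in>Pow (V - {i}). of_bool (i \<in> S) * g S)
      + (\<Sum>S\<in>Pow (V - {i}). of_bool (i \<in> insert i S) * g (insert i S))"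
    by (subst V, subst sum_Pow_insert) (use assms in auto)
  also have "(\<Sum>S\<in>Pow (V - {i}). of_bool (i \<in> S) * g S) = 0"
    by (intro sum.neutral) auto
  finally show ?thesis by simp
qed

text \<open>Double counting: \<open>S\<close> arises once from each of its elements.\<close>

lemma sum_Pow_elements:
  fixes g :: "'a set \<Rightarrow> real"
  assumes "finite V"
  shows "(\<Sum>i\<in>V. \<Sum>S\<in>Pow (V - {i}). g (insert i S)) = (\<Sum>S\<in>Pow V. real (card S) * g S)"
proof -
  have "(\<Sum>i\<in>V. \<Sum>S\<in>Pow (V - {i}). g (insert i S))
      = (\<Sum>i\<in>V. \<Sum>S\<in>Pow V. of_bool (i \<in> S) * g S)"
    by (intro sum.cong refl sum_Pow_containing assms)
  also have "\<dots> = (\<Sum>S\<in>Pow V. \<Sum>i\<in>V. of_bool (i \<in> S) * g S)"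
    by (rule sum.swap)
  also have "\<dots> = (\<Sum>S\<in>Pow V. real (card S) * g S)"
  proof (intro sum.cong refl)
    fix S assume "S \<in> Pow V"
    then have "(\<Sum>i\<in>V. of_bool (i \<in> S)) = (\<Sum>i\<in>S. (1::real))"
      using assms by (intro sum.mono_neutral_cong_right) auto
    then show "(\<Sum>i\<in>V. of_bool (i \<in> S) * g S) = real (card S) * g S"
      by (simp flip: sum_distrib_right)
  qed
  finally show ?thesis .
qed

lemma infl_nonneg: "0 \<le> q \<Longrightarrow> q \<le> 1 \<Longrightarrow> 0 \<le> infl d q V f i"
  unfolding infl_def by (intro sum_nonneg mult_nonneg_nonneg wt_nonneg) auto

lemma card_insert_Pow: "finite V \<Longrightarrow> S \<in> Pow (V - {i}) \<Longrightarrow> card (insert i S) = Suc (card S)"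
  by (subst card_insert_disjoint) (auto intro: finite_subset)

lemma sum_infl_le:
  assumes V: "finite V" and q: "0 < q" "q < 1" and f: "\<And>x. x \<subseteq> V \<Longrightarrow> f x \<in> {0..1}"
  shows "(\<Sum>i\<in>V. infl d q V f i) \<le> real d"
proof -
  \<comment> \<open>\<open>infl\<close> sums over sets without \<open>i\<close>; the condition
    \<open>card S < d\<close> there reads \<open>card S \<le> d\<close> once \<open>i\<close> is
    included.\<close>
  define g where "g S = of_bool (card S \<le> d) * wt q V f S" for S
  have "(\<Sum>i\<in>V. infl d q V f i) = (\<Sum>i\<in>V. \<Sum>S\<in>Pow (V - {i}). g (insert i S))"
    unfolding infl_def g_def
    by (intro sum.cong refl) (auto simp: card_insert_Pow[OF V] Suc_le_eq)
  also have "\<dots> = (\<Sum>S\<in>Pow V. real (card S) * g S)"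
    by (rule sum_Pow_elements[OF V])
  also have "\<dots> \<le> (\<Sum>S\<in>Pow V. real d * wt q V f S)"
    using q unfolding g_def by (intro sum_mono) (auto intro!: mult_right_mono mult_nonneg_nonneg wt_nonneg)
  also have "\<dots> \<le> real d * 1"
    unfolding sum_distrib_left[symmetric] by (intro mult_left_mono sum_wt_le_1 V q f) auto
  finally show ?thesis by simp
qed

text \<open>Inserting \<open>i\<close> raises the factor of \<open>i\<close> in a character by 1 and
  leaves characters without \<open>i\<close> unchanged. So only coefficients of sets containing
  \<open>i\<close> survive.\<close>

lemma thinning_difference:
  assumes V: "finite V" and q: "0 < q" "q < 1" and t: "t > 0" and i: "i \<in> V" and x: "x \<subseteq> V - {i}"
  shows "bexp (q / t) (insert i x) f - bexp (q / t) x f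
    = four t (V - {i}) (\<lambda>S. (q / t) ^ card (insert i S) * coef q V f (insert i S)) x"
proof -
  have "bexp (q / t) y f = four t V (\<lambda>S. (q / t) ^ card S * coef q V f S) y" if "y \<subseteq> V" for y
  proof -
    have "bexp (q / t) y f = bexp (q / t) y (four q V (coef q V f))"
      using four_coef[OF V _ q] that by (intro bexp_cong) (metis order_trans)
    then show ?thesis using bexp_four[OF V that, of q "q / t" t] t by simp
  qed
  note F = this
  have Vi: "V = insert i (V - {i})" "finite (V - {i})" "i \<notin> V - {i}" using i V by auto
  have xV: "insert i x \<subseteq> V" "x \<subseteq> V" "i \<notin> x" using x i by auto
  define a where "a S = (q / t) ^ card S * coef q V f S" for S
  have e: "four t V a y = four t (V - {i}) a y
      + (of_bool (i \<in> y) - t) * four t (V - {i}) (\<lambda>S. a (insert i S)) y" for y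
    by (subst Vi(1)) (rule four_insert[OF Vi(2,3)])
  show ?thesis
    unfolding F[OF xV(1)] F[OF xV(2)] a_def[symmetric] e[of x] e[of "insert i x"]
    using Vi(3) xV(3) by (simp add: four_insert_point algebra_simps)
qed

text \<open>Split the discrete derivative into \<open>P\<close> of degree below \<open>d\<close> and
  the rest \<open>Q\<close>; a jump forces one of them to be at least \<open>\<eta> / 4\<close>. For
  \<open>P\<close> use the fourth moment, which is quadratic in the influence and so gains a factor
  \<open>\<tau>\<close>; for \<open>Q\<close> use the second moment, where thinning damps high
  degrees geometrically.\<close>

lemma sum_jumps_le:
  fixes f :: "'a set \<Rightarrow> real"
  assumes V: "finite V" and q: "0 < q" "q \<le> t" "t < 1" and \<eta>: "\<eta> > 0"
    and f: "\<And>x. x \<subseteq> V \<Longrightarrow> f x \<in> {0..1}"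
    and C: "C \<ge> 4" "C\<^sup>2 * (t * (1 - t)) \<ge> 3"
    and \<mu>: "q * (1 - t) / (t * (1 - q)) \<le> \<mu>" "\<mu> \<le> 1"
    and \<omega>: "\<And>k. k > d \<Longrightarrow> real k * \<mu> ^ k \<le> \<omega>" "\<omega> \<ge> 0"
    and \<tau>: "\<And>i. i \<in> V \<Longrightarrow> infl d q V f i \<le> \<tau>" "\<tau> \<ge> 0"
  shows "(\<Sum>i\<in>V. bexp t (V - {i}) (\<lambda>x.
      of_bool (bexp (q / t) (insert i x) f - bexp (q / t) x f \<ge> \<eta> / 2)))
    \<le> (4 / \<eta>) ^ 4 * ((C ^ d / (t * (1 - t)))\<^sup>2 * \<tau> * real d)
      + (4 / \<eta>)\<^sup>2 * (\<omega> / (t * (1 - t)))"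
proof -
  define s where "s = t * (1 - t)"
  \<comment> \<open>The factor per coordinate by which thinning shrinks Fourier weight:
    \<open>(q / t)\<^sup>2\<close> times the ratio of the variances \<open>t * (1 - t)\<close> and
    \<open>q * (1 - q)\<close>.\<close>
  define \<rho> where "\<rho> = q * (1 - t) / (t * (1 - q))"
  have s: "s > 0" unfolding s_def using q by simp
  have \<rho>: "0 \<le> \<rho>" "\<rho> \<le> \<mu>" "\<rho> \<le> 1"
    using q \<mu> order_trans[OF \<mu>] unfolding \<rho>_def by (simp_all del: divide_le_eq_1_pos)
  define c where "c = coef q V f"
  define a where "a i S = (q / t) ^ card (insert i S) * c (insert i S)" for i S
  define P where "P i = four t (V - {i}) (\<lambda>S. of_bool (card S < d) * a i S)" for i
  define Q where "Q i = four t (V - {i}) (\<lambda>S. of_bool (card S \<ge> d) * a i S)" for i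
  have D: "bexp (q / t) (insert i x) f - bexp (q / t) x f = P i x + Q i x"
    if "i \<in> V" "x \<subseteq> V - {i}" for i x
  proof -
    have "bexp (q / t) (insert i x) f - bexp (q / t) x f = four t (V - {i}) (a i) x"
      unfolding a_def c_def using q by (intro thinning_difference V that) auto
    also have "\<dots> = four t (V - {i}) (\<lambda>S. of_bool (card S < d) * a i S + of_bool (card S \<ge> d) * a i S) x"
      by (intro four_cong) auto
    finally show ?thesis unfolding P_def Q_def four_add .
  qed
  have a: "(a i S)\<^sup>2 * s ^ card S = \<rho> ^ card (insert i S) * wt q V f (insert i S) / s"
    if "S \<in> Pow (V - {i})" for i S
  proof -
    define k where "k = card (insert i S)"
    have k: "k = Suc (card S)" unfolding k_def by (rule card_insert_Pow[OF V that])
    have "(q / t)\<^sup>2 * s = \<rho> * (q * (1 - q))"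
      using q unfolding s_def \<rho>_def by (simp add: power2_eq_square divide_simps)
    then have "((q / t)\<^sup>2) ^ k * s ^ k = \<rho> ^ k * (q * (1 - q)) ^ k"
      by (metis power_mult_distrib)
    moreover have "s ^ card S = s ^ k / s" using k s by simp
    ultimately show ?thesis
      unfolding a_def wt_def c_def k_def[symmetric]
      by (simp add: power_mult_distrib mult.commute mult.left_commute flip: power_mult)
  qed
  \<comment> \<open>The pointwise form of Markov's inequality for the fourth and second
    moments.\<close>
  have ind: "of_bool (P i x + Q i x \<ge> \<eta> / 2) \<le> (4 / \<eta>) ^ 4 * P i x ^ 4 + (4 / \<eta>)\<^sup>2 * (Q i x)\<^sup>2"
    for i x
  proof (cases "P i x + Q i x \<ge> \<eta> / 2")
    case True
    then consider "P i x \<ge> \<eta> / 4" | "Q i x \<ge> \<eta> / 4" by linarith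
    then have "1 \<le> (4 / \<eta> * P i x) ^ 4 \<or> 1 \<le> (4 / \<eta> * Q i x)\<^sup>2"
    proof cases
      case 1
      then have "1 \<le> 4 / \<eta> * P i x" using \<eta> by (simp add: field_simps)
      then show ?thesis by (intro disjI1 one_le_power)
    next
      case 2
      then have "1 \<le> 4 / \<eta> * Q i x" using \<eta> by (simp add: field_simps)
      then show ?thesis by (intro disjI2 one_le_power)
    qed
    moreover have "0 \<le> (4 / \<eta> * P i x) ^ 4" "0 \<le> (4 / \<eta> * Q i x)\<^sup>2" by simp_all
    ultimately have "1 \<le> (4 / \<eta> * P i x) ^ 4 + (4 / \<eta> * Q i x)\<^sup>2" by linarith
    then show ?thesis using True unfolding power_mult_distrib by simp
  qed (simp add: add_nonneg_nonneg)
  have P4: "bexp t (V - {i}) (\<lambda>x. P i x ^ 4) \<le> (C ^ d / s)\<^sup>2 * (\<tau> * infl d q V f i)"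
    if i: "i \<in> V" for i
  proof -
    have "bexp t (V - {i}) (\<lambda>x. P i x ^ 4)
        \<le> (\<Sum>S\<in>Pow (V - {i}). (C * s) ^ card S * (of_bool (card S < d) * a i S)\<^sup>2)\<^sup>2"
      unfolding P_def s_def using V q C by (intro four_4th_moment) auto
    also have "\<dots> \<le> (C ^ d / s * infl d q V f i)\<^sup>2"
      unfolding infl_def sum_distrib_left
    proof (intro power_mono sum_mono sum_nonneg)
      fix S assume S: "S \<in> Pow (V - {i})"
      have "(C * s) ^ card S * (a i S)\<^sup>2 \<le> C ^ d / s * wt q V f (insert i S)" if "card S < d"
      proof -
        have "(C * s) ^ card S * (a i S)\<^sup>2 = C ^ card S * ((a i S)\<^sup>2 * s ^ card S)"
          by (simp add: power_mult_distrib)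
        also have "\<dots> = (C ^ card S * \<rho> ^ card (insert i S)) * (wt q V f (insert i S) / s)"
          unfolding a[OF S] by simp
        also have "\<dots> \<le> (C ^ d * 1) * (wt q V f (insert i S) / s)"
          using that C \<rho> s q wt_nonneg[of q V f "insert i S"]
          by (intro mult_right_mono mult_mono power_increasing power_le_one) auto
        finally show ?thesis by simp
      qed
      then show "(C * s) ^ card S * (of_bool (card S < d) * a i S)\<^sup>2
          \<le> C ^ d / s * (of_bool (card S < d) * wt q V f (insert i S))"
        by simp
      show "0 \<le> (C * s) ^ card S * (of_bool (card S < d) * a i S)\<^sup>2"
        using C s by simp
    qed
    also have "\<dots> = (C ^ d / s)\<^sup>2 * (infl d q V f i * infl d q V f i)"
      by (simp add: power2_eq_square)
    \<comment> \<open>Only one of the two influences is bounded by \<open>\<tau>\<close>; the other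
      is kept because its sum over \<open>i\<close> is at most \<open>d\<close>.\<close>
    also have "\<dots> \<le> (C ^ d / s)\<^sup>2 * (\<tau> * infl d q V f i)"
      using \<tau>(1)[OF i] q by (intro mult_left_mono mult_right_mono infl_nonneg) auto
    finally show ?thesis .
  qed
  define g where "g S = of_bool (card S > d) * (\<mu> ^ card S * wt q V f S)" for S
  have Q2: "bexp t (V - {i}) (\<lambda>x. (Q i x)\<^sup>2) \<le> (\<Sum>S\<in>Pow (V - {i}). g (insert i S)) / s" for i
  proof -
    have "bexp t (V - {i}) (\<lambda>x. (Q i x)\<^sup>2)
        = (\<Sum>S\<in>Pow (V - {i}). (of_bool (card S \<ge> d) * a i S)\<^sup>2 * s ^ card S)"
      unfolding Q_def s_def using V by (intro bexp_four_square) auto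
    also have "\<dots> \<le> (\<Sum>S\<in>Pow (V - {i}). g (insert i S) / s)"
    proof (intro sum_mono)
      fix S assume S: "S \<in> Pow (V - {i})"
      have "(of_bool (card S \<ge> d) * a i S)\<^sup>2 * s ^ card S
          = of_bool (card S \<ge> d) * ((a i S)\<^sup>2 * s ^ card S)"
        by (simp add: power_mult_distrib)
      also have "\<dots> = of_bool (card S \<ge> d) * (\<rho> ^ card (insert i S) * wt q V f (insert i S) / s)"
        unfolding a[OF S] ..
      also have "\<dots> \<le> of_bool (card S \<ge> d) * (\<mu> ^ card (insert i S) * wt q V f (insert i S) / s)"
        using \<rho> s q wt_nonneg[of q V f "insert i S"]
        by (intro mult_left_mono divide_right_mono mult_right_mono power_mono) auto
      also have "\<dots> = g (insert i S) / s"
        unfolding g_def card_insert_Pow[OF V S] by (simp add: less_Suc_eq_le)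
      finally show "(of_bool (card S \<ge> d) * a i S)\<^sup>2 * s ^ card S \<le> g (insert i S) / s" .
    qed
    finally show ?thesis by (simp add: sum_divide_distrib)
  qed
  \<comment> \<open>Summing over \<open>i\<close> counts each \<open>S\<close> with multiplicity
    \<open>card S\<close>; this is the factor \<open>k\<close> in the hypothesis on
    \<open>k * \<mu> ^ k\<close>.\<close>
  have g: "(\<Sum>i\<in>V. \<Sum>S\<in>Pow (V - {i}). g (insert i S)) \<le> \<omega>"
  proof -
    have "(\<Sum>i\<in>V. \<Sum>S\<in>Pow (V - {i}). g (insert i S)) = (\<Sum>S\<in>Pow V. real (card S) * g S)"
      by (rule sum_Pow_elements[OF V])
    also have "\<dots> \<le> (\<Sum>S\<in>Pow V. \<omega> * wt q V f S)"
    proof (intro sum_mono)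
      fix S
      have w: "wt q V f S \<ge> 0" using q by (intro wt_nonneg) auto
      show "real (card S) * g S \<le> \<omega> * wt q V f S"
        using mult_right_mono[OF \<omega>(1)[of "card S"] w] w \<omega>(2) unfolding g_def
        by (cases "card S > d") (auto simp: mult.assoc)
    qed
    also have "\<dots> \<le> \<omega> * 1"
      unfolding sum_distrib_left[symmetric] using q \<omega>
      by (intro mult_left_mono sum_wt_le_1 V f) auto
    finally show ?thesis by simp
  qed
  have "(\<Sum>i\<in>V. bexp t (V - {i}) (\<lambda>x.
      of_bool (bexp (q / t) (insert i x) f - bexp (q / t) x f \<ge> \<eta> / 2)))
    \<le> (\<Sum>i\<in>V. bexp t (V - {i}) (\<lambda>x. (4 / \<eta>) ^ 4 * P i x ^ 4 + (4 / \<eta>)\<^sup>2 * (Q i x)\<^sup>2))"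
    using q by (intro sum_mono bexp_mono) (auto simp only: D intro: ind)
  also have "\<dots> = (4 / \<eta>) ^ 4 * (\<Sum>i\<in>V. bexp t (V - {i}) (\<lambda>x. P i x ^ 4))
      + (4 / \<eta>)\<^sup>2 * (\<Sum>i\<in>V. bexp t (V - {i}) (\<lambda>x. (Q i x)\<^sup>2))"
    unfolding bexp_add bexp_cmult sum.distrib sum_distrib_left ..
  also have "\<dots> \<le> (4 / \<eta>) ^ 4 * (\<Sum>i\<in>V. (C ^ d / s)\<^sup>2 * (\<tau> * infl d q V f i))
      + (4 / \<eta>)\<^sup>2 * (\<Sum>i\<in>V. (\<Sum>S\<in>Pow (V - {i}). g (insert i S)) / s)"
    by (intro add_mono mult_left_mono sum_mono P4 Q2) auto
  also have "\<dots> = (4 / \<eta>) ^ 4 * ((C ^ d / s)\<^sup>2 * \<tau> * (\<Sum>i\<in>V. infl d q V f i))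
      + (4 / \<eta>)\<^sup>2 * ((\<Sum>i\<in>V. \<Sum>S\<in>Pow (V - {i}). g (insert i S)) / s)"
    by (simp add: sum_distrib_left sum_divide_distrib mult.assoc)
  also have "\<dots> \<le> (4 / \<eta>) ^ 4 * ((C ^ d / s)\<^sup>2 * \<tau> * real d) + (4 / \<eta>)\<^sup>2 * (\<omega> / s)"
    using s q \<tau> by (intro add_mono mult_left_mono divide_right_mono g sum_infl_le V f) auto
  finally show ?thesis unfolding s_def .
qed

subsection \<open>Exposing influential coordinates\<close>

text \<open>On average over the exposed values, exposing \<open>i\<close> lowers this potential by at least \<open>infl d q V f i\<close>.\<close>

definition pot :: "nat \<Rightarrow> real \<Rightarrow> 'a set \<Rightarrow> ('a set \<Rightarrow> real) \<Rightarrow> real" where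
  "pot d q V f = (\<Sum>S\<in>Pow V. real (min (card S) d) * wt q V f S)"

section \<open>Fourier weights of sections\<close>

lemma chi_Un:
  assumes "finite U" "finite S" "U \<subseteq> J" "S \<subseteq> K" "J \<inter> K = {}" "a \<subseteq> J" "b \<subseteq> K"
  shows "chi q (U \<union> S) (a \<union> b) = chi q U a * chi q S b"
proof -
  have "chi q (U \<union> S) (a \<union> b) = chi q U (a \<union> b) * chi q S (a \<union> b)"
    unfolding chi_def using assms by (intro prod.union_disjoint) auto
  also have "chi q U (a \<union> b) = chi q U a"
    unfolding chi_def using assms by (intro prod.cong) auto
  also have "chi q S (a \<union> b) = chi q S b"
    unfolding chi_def using assms by (intro prod.cong) auto
  finally show ?thesis .
qed

text \<open>Both sides integrate \<open>f\<close> against the product of a character in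
  \<open>a\<close> and a character in \<open>b\<close>, once in two stages and once jointly.\<close>

lemma coef_section:
  assumes "finite J" "finite K" "J \<inter> K = {}" "U \<subseteq> J" "S \<subseteq> K"
  shows "coef q J (\<lambda>a. coef q K (\<lambda>b. f (a \<union> b)) S) U = coef q (J \<union> K) f (U \<union> S)"
proof -
  have fin: "finite U" "finite S" using assms by (auto intro: finite_subset)
  have c: "card (U \<union> S) = card U + card S"
    using fin assms by (intro card_Un_disjoint) auto
  have "bexp q (J \<union> K) (\<lambda>x. f x * chi q (U \<union> S) x)
      = bexp q J (\<lambda>a. bexp q K (\<lambda>b. chi q U a * (f (a \<union> b) * chi q S b)))"
    unfolding bexp_Un[OF assms(1-3)]
    by (intro bexp_cong) (simp add: chi_Un[OF fin assms(4,5,3)])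
  also have "\<dots> = bexp q J (\<lambda>a. bexp q K (\<lambda>b. f (a \<union> b) * chi q S b) * chi q U a)"
    by (simp add: bexp_cmult mult.commute)
  finally show ?thesis
    unfolding coef_def c power_add times_divide_eq_left bexp_divide by (simp add: mult.commute)
qed

text \<open>Parseval over \<open>J\<close>: as a function of the exposed point \<open>a\<close>, the
  coefficient of the section at \<open>S\<close> has Fourier coefficients
  \<open>coef q (J \<union> K) f (U \<union> S)\<close>.\<close>

lemma bexp_wt_section:
  assumes JK: "finite J" "finite K" "J \<inter> K = {}" and S: "S \<subseteq> K" and q: "0 < q" "q < 1"
  shows "bexp q J (\<lambda>a. wt q K (\<lambda>b. f (a \<union> b)) S) = (\<Sum>U\<in>Pow J. wt q (J \<union> K) f (U \<union> S))"
proof -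
  define c where "c U = coef q (J \<union> K) f (U \<union> S)" for U
  have "coef q K (\<lambda>b. f (a \<union> b)) S = four q J c a" if "a \<subseteq> J" for a
  proof -
    have "coef q K (\<lambda>b. f (a \<union> b)) S
        = four q J (coef q J (\<lambda>a. coef q K (\<lambda>b. f (a \<union> b)) S)) a"
      using four_coef[OF JK(1) that q, of "\<lambda>a. coef q K (\<lambda>b. f (a \<union> b)) S"] by simp
    also have "\<dots> = four q J c a"
      unfolding c_def using coef_section[OF JK _ S] by (intro four_cong) auto
    finally show ?thesis .
  qed
  then have "bexp q J (\<lambda>a. wt q K (\<lambda>b. f (a \<union> b)) S)
      = bexp q J (\<lambda>a. (q * (1 - q)) ^ card S * (four q J c a)\<^sup>2)"
    unfolding wt_def by (intro bexp_cong) simp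
  also have "\<dots> = (q * (1 - q)) ^ card S * (\<Sum>U\<in>Pow J. (c U)\<^sup>2 * (q * (1 - q)) ^ card U)"
    unfolding bexp_cmult bexp_four_square[OF JK(1)] ..
  also have "\<dots> = (\<Sum>U\<in>Pow J. wt q (J \<union> K) f (U \<union> S))"
    unfolding sum_distrib_left
  proof (intro sum.cong refl)
    fix U assume "U \<in> Pow J"
    then have "card (U \<union> S) = card U + card S"
      using JK S by (intro card_Un_disjoint) (auto intro: finite_subset)
    then show "(q * (1 - q)) ^ card S * ((c U)\<^sup>2 * (q * (1 - q)) ^ card U) = wt q (J \<union> K) f (U \<union> S)"
      unfolding wt_def c_def by (simp add: power_add)
  qed
  finally show ?thesis .
qed

lemma sum_Pow_Un:
  fixes g :: "'a set \<Rightarrow> real"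
  assumes "finite J" "finite K" "J \<inter> K = {}"
  shows "(\<Sum>S\<in>Pow (J \<union> K). g S) = (\<Sum>S\<in>Pow K. \<Sum>U\<in>Pow J. g (U \<union> S))"
  using assms
proof (induction J arbitrary: g rule: finite_induct)
  case (insert j J)
  then have "finite (J \<union> K)" "j \<notin> J \<union> K" "J \<inter> K = {}" by auto
  with insert show ?case
    by (simp add: sum_Pow_insert sum.distrib)
qed simp

text \<open>On average over the exposed values, the weight of \<open>S\<close> moves to
  \<open>S - J\<close>.\<close>

lemma bexp_pot_section:
  assumes V: "finite V" "J \<subseteq> V" and q: "0 < q" "q < 1"
  shows "bexp q J (\<lambda>a. pot d q (V - J) (\<lambda>b. f (a \<union> b)))
    = (\<Sum>S\<in>Pow V. real (min (card (S - J)) d) * wt q V f S)"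
proof -
  define K where "K = V - J"
  have JK: "finite J" "finite K" "J \<inter> K = {}" "J \<union> K = V"
    using V finite_subset unfolding K_def by auto
  have "bexp q J (\<lambda>a. pot d q K (\<lambda>b. f (a \<union> b)))
      = (\<Sum>S\<in>Pow K. real (min (card S) d) * bexp q J (\<lambda>a. wt q K (\<lambda>b. f (a \<union> b)) S))"
    unfolding pot_def bexp_sum bexp_cmult ..
  also have "\<dots> = (\<Sum>S\<in>Pow K. \<Sum>U\<in>Pow J. real (min (card (U \<union> S - J)) d) * wt q V f (U \<union> S))"
  proof (intro sum.cong refl)
    fix S assume S: "S \<in> Pow K"
    have "real (min (card S) d) * bexp q J (\<lambda>a. wt q K (\<lambda>b. f (a \<union> b)) S)
        = (\<Sum>U\<in>Pow J. real (min (card S) d) * wt q V f (U \<union> S))"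
      using S bexp_wt_section[OF JK(1-3) _ q] JK(4) by (simp add: sum_distrib_left)
    also have "\<dots> = (\<Sum>U\<in>Pow J. real (min (card (U \<union> S - J)) d) * wt q V f (U \<union> S))"
    proof (intro sum.cong refl)
      fix U assume "U \<in> Pow J"
      then have "U \<union> S - J = S" using S JK by auto
      then show "real (min (card S) d) * wt q V f (U \<union> S)
          = real (min (card (U \<union> S - J)) d) * wt q V f (U \<union> S)" by simp
    qed
    finally show "real (min (card S) d) * bexp q J (\<lambda>a. wt q K (\<lambda>b. f (a \<union> b)) S)
        = (\<Sum>U\<in>Pow J. real (min (card (U \<union> S - J)) d) * wt q V f (U \<union> S))" .
  qed
  also have "\<dots> = (\<Sum>S\<in>Pow V. real (min (card (S - J)) d) * wt q V f S)"
    using sum_Pow_Un[OF JK(1-3), of "\<lambda>S. real (min (card (S - J)) d) * wt q V f S"]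
    unfolding JK(4) by (rule sym)
  finally show ?thesis unfolding K_def .
qed

lemma bexp_pot_section_le:
  assumes V: "finite V" "J \<subseteq> V" and q: "0 < q" "q < 1"
  shows "bexp q J (\<lambda>a. pot d q (V - J) (\<lambda>b. f (a \<union> b))) \<le> pot d q V f"
  unfolding bexp_pot_section[OF assms] unfolding pot_def
proof (intro sum_mono mult_right_mono)
  fix S assume "S \<in> Pow V"
  then have "card (S - J) \<le> card S" using V by (intro card_mono) (auto intro: finite_subset)
  then show "real (min (card (S - J)) d) \<le> real (min (card S) d)" by simp
qed (use q in \<open>auto intro: wt_nonneg\<close>)

text \<open>For a set \<open>S\<close> containing \<open>i\<close>, removing \<open>J\<close> lowers
  the cardinality by at least 1. If \<open>card S \<le> d\<close>, the truncated cardinality drops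
  too, and these sets are exactly the ones counted by \<open>infl\<close>.\<close>

lemma bexp_pot_section_le_infl:
  assumes V: "finite V" "J \<subseteq> V" and q: "0 < q" "q < 1" and i: "i \<in> J"
  shows "bexp q J (\<lambda>a. pot d q (V - J) (\<lambda>b. f (a \<union> b))) \<le> pot d q V f - infl d q V f i"
proof -
  define g where "g S = of_bool (card S \<le> d) * wt q V f S" for S
  have iV: "i \<in> V" using V i by auto
  have "infl d q V f i = (\<Sum>S\<in>Pow (V - {i}). g (insert i S))"
    unfolding infl_def g_def
    by (intro sum.cong refl) (simp add: card_insert_Pow[OF V(1)] Suc_le_eq)
  also have "\<dots> = (\<Sum>S\<in>Pow V. of_bool (i \<in> S) * g S)"
    by (rule sum_Pow_containing[OF V(1) iV])
  finally have I: "infl d q V f i = (\<Sum>S\<in>Pow V. of_bool (i \<in> S) * g S)" .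
  have "(\<Sum>S\<in>Pow V. real (min (card (S - J)) d) * wt q V f S) \<le>
     (\<Sum>S\<in>Pow V. real (min (card S) d) * wt q V f S - of_bool (i \<in> S) * g S)"
  proof (intro sum_mono)
    fix S assume "S \<in> Pow V"
    then have fin: "finite S" using V finite_subset by auto
    have "card (S - J) \<le> card S" using fin by (intro card_mono) auto
    moreover have "card (S - J) < card S" if "i \<in> S"
      using fin i that by (intro psubset_card_mono) auto
    ultimately have "real (min (card (S - J)) d)
        \<le> real (min (card S) d) - of_bool (i \<in> S \<and> card S \<le> d)"
      by (cases "i \<in> S"; cases "card S \<le> d") auto
    then have "real (min (card (S - J)) d) * wt q V f S
        \<le> (real (min (card S) d) - of_bool (i \<in> S \<and> card S \<le> d)) * wt q V f S"
      using q by (intro mult_right_mono wt_nonneg) auto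
    then show "real (min (card (S - J)) d) * wt q V f S
        \<le> real (min (card S) d) * wt q V f S - of_bool (i \<in> S) * g S"
      unfolding g_def of_bool_conj left_diff_distrib mult.assoc .
  qed
  then show ?thesis
    unfolding bexp_pot_section[OF V q] I sum_subtractf by (simp only: pot_def)
qed

text \<open>One step exposes an influential coordinate for each of the at most \<open>2 ^ card J\<close> sections over \<open>J\<close>.\<close>

fun tower :: "nat \<Rightarrow> nat" where
  "tower 0 = 0"
| "tower (Suc k) = tower k + 2 ^ tower k"

lemma tower_mono: "k \<le> l \<Longrightarrow> tower k \<le> tower l"
  by (rule lift_Suc_mono_le[of tower]) auto

text \<open>An energy decrement argument. While bad sections have probability above
  \<open>\<beta>\<close>, exposing an influential coordinate for each of them lowers the mean
  potential by at least \<open>\<tau> * \<beta>\<close>. It starts at most \<open>d\<close> and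
  stays nonnegative, so this cannot happen \<open>N\<close> times.\<close>

lemma uninfluential_sections:
  fixes f :: "'a set \<Rightarrow> real"
  assumes V: "finite V" and q: "0 < q" "q < 1" and f: "\<And>x. x \<subseteq> V \<Longrightarrow> f x \<in> {0..1}"
    and \<tau>: "\<tau> > 0" and N: "real d < real N * (\<tau> * \<beta>)"
  shows "\<exists>J\<subseteq>V. card J \<le> tower N \<and>
    bexp q J (\<lambda>a. of_bool (\<exists>i\<in>V - J. infl d q (V - J) (\<lambda>b. f (a \<union> b)) i > \<tau>)) \<le> \<beta>"
proof (rule ccontr)
  define bad where "bad J a \<longleftrightarrow> (\<exists>i\<in>V - J. infl d q (V - J) (\<lambda>b. f (a \<union> b)) i > \<tau>)" for J a
  define W where "W J = bexp q J (\<lambda>a. pot d q (V - J) (\<lambda>b. f (a \<union> b)))" for J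
  assume no: "\<not> ?thesis"
  have *: "\<exists>J\<subseteq>V. card J \<le> tower k \<and> W J \<le> real d - real k * (\<tau> * \<beta>)" if "k \<le> N" for k
    using that
  proof (induction k)
    case 0
    have "W {} = (\<Sum>S\<in>Pow V. real (min (card S) d) * wt q V f S)"
      unfolding W_def by (simp add: pot_def)
    also have "\<dots> \<le> (\<Sum>S\<in>Pow V. real d * wt q V f S)"
      using q by (intro sum_mono mult_right_mono wt_nonneg) auto
    also have "\<dots> \<le> real d * 1"
      unfolding sum_distrib_left[symmetric] by (intro mult_left_mono sum_wt_le_1 V q f) auto
    finally show ?case by (intro exI[of _ "{}"]) simp
  next
    case (Suc k)
    then obtain J where J: "J \<subseteq> V" "card J \<le> tower k" "W J \<le> real d - real k * (\<tau> * \<beta>)"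
      by auto
    have finJ: "finite J" using J V finite_subset by auto
    have "card J \<le> tower N" using J(2) tower_mono[of k N] Suc.prems by simp
    then have big: "bexp q J (\<lambda>a. of_bool (bad J a)) > \<beta>"
      using no J(1) unfolding bad_def by force
    define \<iota> where "\<iota> a = (SOME i. i \<in> V - J \<and> infl d q (V - J) (\<lambda>b. f (a \<union> b)) i > \<tau>)" for a
    have \<iota>: "\<iota> a \<in> V - J \<and> infl d q (V - J) (\<lambda>b. f (a \<union> b)) (\<iota> a) > \<tau>" if "bad J a" for a
    proof -
      have "\<exists>i. i \<in> V - J \<and> infl d q (V - J) (\<lambda>b. f (a \<union> b)) i > \<tau>"
        using that unfolding bad_def by blast
      then show ?thesis unfolding \<iota>_def by (rule someI_ex)
    qed
    \<comment> \<open>The same coordinates are exposed over every \<open>a\<close>, so that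
      \<open>J \<union> I\<close> is a fixed set; those chosen for other sections cannot raise the
      mean potential.\<close>
    define I where "I = \<iota> ` {a \<in> Pow J. bad J a}"
    have I: "I \<subseteq> V - J" unfolding I_def using \<iota> by auto
    then have finI: "finite I" using V finite_subset by auto
    have "card I \<le> card {a \<in> Pow J. bad J a}"
      unfolding I_def using finJ by (intro card_image_le) auto
    also have "\<dots> \<le> card (Pow J)" using finJ by (intro card_mono) auto
    also have "\<dots> = 2 ^ card J" using finJ by (rule card_Pow)
    also have "\<dots> \<le> 2 ^ tower k" using J(2) by (intro power_increasing) auto
    finally have "card (J \<union> I) \<le> tower (Suc k)"
      using card_Un_le[of J I] J(2) by simp
    moreover have "J \<union> I \<subseteq> V" using I J by auto
    moreover have "W (J \<union> I) \<le> real d - real (Suc k) * (\<tau> * \<beta>)"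
    proof -
      have "J \<inter> I = {}" using I by auto
      moreover have "V - (J \<union> I) = V - J - I" by auto
      ultimately have "W (J \<union> I)
          = bexp q J (\<lambda>a. bexp q I (\<lambda>e. pot d q (V - J - I) (\<lambda>b. f (a \<union> (e \<union> b)))))"
        unfolding W_def by (simp only: bexp_Un[OF finJ finI] Un_assoc)
      also have "\<dots> \<le> bexp q J (\<lambda>a. pot d q (V - J) (\<lambda>b. f (a \<union> b)) - \<tau> * of_bool (bad J a))"
      proof (intro bexp_mono)
        fix a assume a: "a \<subseteq> J"
        have fin: "finite (V - J)" using V by auto
        show "bexp q I (\<lambda>e. pot d q (V - J - I) (\<lambda>b. f (a \<union> (e \<union> b))))
          \<le> pot d q (V - J) (\<lambda>b. f (a \<union> b)) - \<tau> * of_bool (bad J a)"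
        proof (cases "bad J a")
          case True
          then have "\<iota> a \<in> I" unfolding I_def using a by auto
          from bexp_pot_section_le_infl[OF fin I q this, of d "\<lambda>b. f (a \<union> b)"]
          show ?thesis using \<iota>[OF True] True by simp
        next
          case False
          then show ?thesis
            using bexp_pot_section_le[OF fin I q, of d "\<lambda>b. f (a \<union> b)"] by simp
        qed
      qed (use q in auto)
      also have "\<dots> = W J - \<tau> * bexp q J (\<lambda>a. of_bool (bad J a))"
        unfolding W_def bexp_diff bexp_cmult ..
      also have "\<dots> \<le> (real d - real k * (\<tau> * \<beta>)) - \<tau> * \<beta>"
        using J(3) big \<tau> by (intro diff_mono mult_left_mono) auto
      also have "\<dots> = real d - real (Suc k) * (\<tau> * \<beta>)" by (simp add: algebra_simps)
      finally show ?thesis .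
    qed
    ultimately show ?case by blast
  qed
  from *[of N] obtain J where "W J \<le> real d - real N * (\<tau> * \<beta>)" by auto
  moreover have "W J \<ge> 0"
    unfolding W_def pot_def using q
    by (intro bexp_nonneg sum_nonneg mult_nonneg_nonneg wt_nonneg) auto
  ultimately show False using N by simp
qed

subsection \<open>The correlation bound\<close>

lemma bexp_commute:
  "bexp t V (\<lambda>x. bexp u W (\<lambda>y. g x y)) = bexp u W (\<lambda>y. bexp t V (\<lambda>x. g x y))"
  by (subst (2) bexp_def, subst (2) bexp_def) (simp add: bexp_sum bexp_cmult)

text \<open>Jensen's inequality via the tangent of \<open>ln\<close> at the mean; the bound
  \<open>\<eta> \<le> g x\<close> makes that mean positive.\<close>

lemma bexp_ln_le:
  assumes V: "finite V" and t: "0 \<le> t" "t \<le> 1" and \<eta>: "0 < \<eta>" and g: "\<And>x. x \<subseteq> V \<Longrightarrow> \<eta> \<le> g x"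
  shows "bexp t V (\<lambda>x. ln (g x)) \<le> ln (bexp t V g)"
proof -
  define c where "c = bexp t V g"
  have "bexp t V (\<lambda>_. \<eta>) \<le> c" unfolding c_def using t g by (intro bexp_mono) auto
  then have c: "c > 0" using V \<eta> by (simp add: bexp_const)
  have "bexp t V (\<lambda>x. ln (g x)) \<le> bexp t V (\<lambda>x. ln c + (g x - c) / c)"
  proof (intro bexp_mono t)
    fix x assume "x \<subseteq> V"
    then have "g x > 0" using g[of x] \<eta> by simp
    from ln_diff_le[OF this c] show "ln (g x) \<le> ln c + (g x - c) / c" by simp
  qed
  also have "\<dots> = ln c"
    unfolding bexp_add bexp_divide bexp_diff using V by (simp add: bexp_const c_def)
  finally show ?thesis unfolding c_def .
qed

lemma exists_threshold_power:
  fixes x \<omega> :: real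
  assumes "0 \<le> x" "x < 1" "0 < \<omega>"
  shows "\<exists>d::nat. \<forall>k>d. real k * x ^ k \<le> \<omega>"
proof -
  have "(\<lambda>k. real k * x ^ k) \<longlonglongrightarrow> 0"
    using powser_times_n_limit_0[of x] assms by simp
  then have "\<forall>\<^sub>F k in sequentially. real k * x ^ k < \<omega>"
    using assms(3) by (rule order_tendstoD(2))
  then show ?thesis
    unfolding eventually_at_top_dense by (auto intro: less_imp_le)
qed

text \<open>\<open>d\<close> and \<open>\<tau>\<close> depend on \<open>\<epsilon>\<close> and
  \<open>\<eta>\<close> only. They are chosen so that the high-degree and the low-degree part of
  \<open>sum_jumps_le\<close> each contribute at most \<open>2 / \<Lambda>\<close>.\<close>

lemma bexp_ln_thinning_ge_of_infl:
  fixes \<epsilon> \<eta> :: real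
  assumes \<epsilon>: "0 < \<epsilon>" "\<epsilon> < 1" and \<eta>: "0 < \<eta>"
  shows "\<exists>d. \<exists>\<tau>>0. \<forall>(V::'a set) q p f. finite V \<longrightarrow> \<epsilon> < q \<longrightarrow> q + \<epsilon> < p \<longrightarrow> p < 1 - \<epsilon> \<longrightarrow>
    (\<forall>x\<subseteq>V. f x \<in> {0..1}) \<longrightarrow> \<epsilon> / 2 \<le> bexp q V f \<longrightarrow> (\<forall>i\<in>V. infl d q V f i \<le> \<tau>) \<longrightarrow>
    ln (\<epsilon> / 4) - 16 / \<epsilon>\<^sup>2 \<le> bexp p V (\<lambda>y. ln (bexp (q / p) y f + \<eta>))"
proof -
  define \<Lambda> where "\<Lambda> = (ln ((1 + \<eta>) / \<eta>))\<^sup>2"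
  have \<Lambda>: "\<Lambda> > 0"
  proof -
    have "(1 + \<eta>) / \<eta> > 1" using \<eta> by simp
    then have "ln ((1 + \<eta>) / \<eta>) > 0" by (rule ln_gt_zero)
    then show ?thesis unfolding \<Lambda>_def by simp
  qed
  define \<omega> where "\<omega> = 2 / \<Lambda> * \<epsilon>\<^sup>2 / (4 / \<eta>)\<^sup>2"
  have \<omega>: "\<omega> > 0" unfolding \<omega>_def using \<Lambda> \<epsilon> \<eta> by simp
  \<comment> \<open>Bounds \<open>q / t\<close>, hence the damping factor, since \<open>t\<close>
    will exceed \<open>q\<close> by at least \<open>\<epsilon> / 2\<close>.\<close>
  define \<mu> where "\<mu> = 1 - \<epsilon> / 2"
  obtain d where d: "\<And>k. k > d \<Longrightarrow> real k * \<mu> ^ k \<le> \<omega>"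
    using exists_threshold_power[of \<mu> \<omega>] \<omega> \<epsilon> unfolding \<mu>_def by auto
  define C where "C = 4 / \<epsilon>"
  \<comment> \<open>\<open>real d + 1\<close> instead of \<open>real d\<close> keeps
    \<open>B\<close> positive when \<open>d = 0\<close>.\<close>
  define B where "B = (4 / \<eta>) ^ 4 * (C ^ d / \<epsilon>\<^sup>2)\<^sup>2 * (real d + 1)"
  have B: "B > 0" unfolding B_def C_def using \<epsilon> \<eta> by simp
  define \<tau> where "\<tau> = 2 / \<Lambda> / B"
  have \<tau>: "\<tau> > 0" unfolding \<tau>_def using \<Lambda> B by simp
  have "ln (\<epsilon> / 4) - 16 / \<epsilon>\<^sup>2 \<le> bexp p V (\<lambda>y. ln (bexp (q / p) y f + \<eta>))"
    if V: "finite V" and q: "\<epsilon> < q" and qp: "q + \<epsilon> < p" and p: "p < 1 - \<epsilon>"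
      and f: "\<forall>x\<subseteq>V. f x \<in> {0..1}" and m: "\<epsilon> / 2 \<le> bexp q V f"
      and I: "\<forall>i\<in>V. infl d q V f i \<le> \<tau>" for V :: "'a set" and q p f
  proof -
    \<comment> \<open>The midpoint leaves a gap of at least \<open>\<epsilon> / 2\<close> on both
      sides: below it for the damping factor, above it for the evolution up to
      \<open>p\<close>.\<close>
    define t0 where "t0 = (q + p) / 2"
    have t0: "q \<le> t0" "t0 < p" "\<epsilon> / 2 \<le> p - t0" using qp \<epsilon> unfolding t0_def by (auto simp: field_simps)
    have jumps: "\<Lambda> * (\<Sum>i\<in>V. bexp t (V - {i}) (\<lambda>x.
        of_bool (bexp (q / t) (insert i x) f - bexp (q / t) x f \<ge> \<eta> / 2))) \<le> 4"
      (is "\<Lambda> * ?S \<le> 4") if "t \<in> {t0..p}" for t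
    proof -
      define s where "s = t * (1 - t)"
      have t: "\<epsilon> < t" "\<epsilon> < 1 - t" "q < t" "t < 1" "\<epsilon> / 2 \<le> t - q"
        using that t0 q p qp \<epsilon> unfolding t0_def by auto
      have s: "\<epsilon>\<^sup>2 \<le> s" "s > 0"
        unfolding s_def power2_eq_square using t \<epsilon> by (auto intro: mult_mono)
      have C: "C \<ge> 4" "C\<^sup>2 * s \<ge> 3"
      proof -
        show "C \<ge> 4" unfolding C_def using \<epsilon> by (simp add: field_simps)
        have "3 \<le> C\<^sup>2 * \<epsilon>\<^sup>2" unfolding C_def using \<epsilon> by (simp add: power_divide)
        also have "\<dots> \<le> C\<^sup>2 * s" using s by (intro mult_left_mono) auto
        finally show "C\<^sup>2 * s \<ge> 3" .
      qed
      have \<rho>: "q * (1 - t) / (t * (1 - q)) \<le> \<mu>"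
      proof -
        have "q * (1 - t) / (t * (1 - q)) = (q / t) * ((1 - t) / (1 - q))" by simp
        also have "\<dots> \<le> \<mu> * 1"
        proof (intro mult_mono)
          have "\<epsilon> / 2 * t \<le> \<epsilon> / 2 * 1" using t \<epsilon> by (intro mult_left_mono) auto
          then have "q \<le> (1 - \<epsilon> / 2) * t" using t by (simp add: algebra_simps)
          then show "q / t \<le> \<mu>" unfolding \<mu>_def using t \<epsilon> by (simp add: divide_le_eq)
        qed (use t q \<epsilon> in \<open>auto simp: \<mu>_def\<close>)
        finally show ?thesis by simp
      qed
      have "?S \<le> (4 / \<eta>) ^ 4 * ((C ^ d / s)\<^sup>2 * \<tau> * real d) + (4 / \<eta>)\<^sup>2 * (\<omega> / s)"
        unfolding s_def
        by (rule sum_jumps_le[where \<mu> = \<mu>])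
          (use V q t \<eta> f C \<rho> d \<omega> I \<tau> \<epsilon> in \<open>auto simp: s_def \<mu>_def\<close>)
      also have "\<dots> \<le> (4 / \<eta>) ^ 4 * ((C ^ d / \<epsilon>\<^sup>2)\<^sup>2 * \<tau> * (real d + 1)) + (4 / \<eta>)\<^sup>2 * (\<omega> / \<epsilon>\<^sup>2)"
        using s \<epsilon> \<tau> \<omega> C
        by (intro add_mono mult_left_mono mult_mono power_mono divide_left_mono) auto
      also have "\<dots> = B * \<tau> + (4 / \<eta>)\<^sup>2 * (\<omega> / \<epsilon>\<^sup>2)"
        unfolding B_def by (simp add: mult.assoc mult.left_commute mult.commute)
      also have "\<dots> = 4 / \<Lambda>"
        unfolding \<tau>_def \<omega>_def using B \<epsilon> \<eta> by simp
      finally show ?thesis using \<Lambda> by (simp add: field_simps)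
    qed
    have "ln (\<epsilon> / 2 / 2) - 4 / (\<epsilon> / 2 * (p - t0)) \<le> bexp p V (\<lambda>y. ln (bexp (q / p) y f + \<eta>))"
      by (rule bexp_ln_thinning_ge)
        (use V q t0 p \<eta> f m \<epsilon> jumps in \<open>auto simp: \<Lambda>_def\<close>)
    moreover have "4 / (\<epsilon> / 2 * (p - t0)) \<le> 16 / \<epsilon>\<^sup>2"
    proof -
      have "4 / (\<epsilon> / 2 * (p - t0)) \<le> 4 / (\<epsilon> / 2 * (\<epsilon> / 2))"
        using t0 \<epsilon> by (intro divide_left_mono mult_left_mono) auto
      then show ?thesis by (simp add: power2_eq_square)
    qed
    ultimately show ?thesis by simp
  qed
  with \<tau> show ?thesis by blast
qed

text \<open>Write a \<open>p\<close>-random \<open>y\<close> as \<open>z \<union> w\<close> with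
  \<open>z\<close> in \<open>J\<close>. Then \<open>a\<close> is a thinning of \<open>z\<close>, and
  by concavity averaging the logarithm over \<open>a\<close> gives at most the logarithm of the
  average.\<close>

lemma bexp_ln_thinning_sections:
  fixes f :: "'a set \<Rightarrow> real"
  assumes V: "finite V" "J \<subseteq> V" and u: "0 \<le> u" "u \<le> 1" and p: "0 \<le> p" "p \<le> 1"
    and \<eta>: "0 < \<eta>" and f: "\<And>x. x \<subseteq> V \<Longrightarrow> f x \<in> {0..1}"
  shows "bexp (p * u) J (\<lambda>a. bexp p (V - J) (\<lambda>w. ln (bexp u w (\<lambda>b. f (a \<union> b)) + \<eta>)))
    \<le> bexp p V (\<lambda>y. ln (bexp u y f + \<eta>))"
proof -
  define K where "K = V - J"
  have JK: "finite J" "finite K" "J \<inter> K = {}" "J \<union> K = V"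
    using V finite_subset unfolding K_def by auto
  have "bexp (p * u) J (\<lambda>a. bexp p K (\<lambda>w. ln (bexp u w (\<lambda>b. f (a \<union> b)) + \<eta>)))
    = bexp p J (\<lambda>z. bexp p K (\<lambda>w. bexp u z (\<lambda>a. ln (bexp u w (\<lambda>b. f (a \<union> b)) + \<eta>))))"
    unfolding bexp_tower[OF JK(1), symmetric] by (intro bexp_cong bexp_commute)
  also have "\<dots> \<le> bexp p J (\<lambda>z. bexp p K (\<lambda>w. ln (bexp u (z \<union> w) f + \<eta>)))"
  proof (intro bexp_mono p)
    fix z w assume z: "z \<subseteq> J" and w: "w \<subseteq> K"
    have fin: "finite z" "finite w" "z \<inter> w = {}" using z w JK finite_subset by auto
    have "bexp u w (\<lambda>b. f (a \<union> b)) \<ge> 0" if "a \<subseteq> z" for a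
    proof (intro bexp_nonneg u)
      fix b assume "b \<subseteq> w"
      then have "a \<union> b \<subseteq> V" using that z w JK by auto
      then show "0 \<le> f (a \<union> b)" using f by auto
    qed
    then have "bexp u z (\<lambda>a. ln (bexp u w (\<lambda>b. f (a \<union> b)) + \<eta>))
        \<le> ln (bexp u z (\<lambda>a. bexp u w (\<lambda>b. f (a \<union> b)) + \<eta>))"
      using fin u \<eta> by (intro bexp_ln_le) auto
    also have "\<dots> = ln (bexp u (z \<union> w) f + \<eta>)"
      unfolding bexp_add bexp_Un[OF fin] by (simp add: bexp_const fin)
    finally show "bexp u z (\<lambda>a. ln (bexp u w (\<lambda>b. f (a \<union> b)) + \<eta>)) \<le> ln (bexp u (z \<union> w) f + \<eta>)" .
  qed
  also have "\<dots> = bexp p V (\<lambda>y. ln (bexp u y f + \<eta>))"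
    unfolding JK(4)[symmetric] by (rule bexp_Un[OF JK(1-3), symmetric])
  finally show ?thesis unfolding K_def .
qed

text \<open>\<open>h\<close> stands for \<open>1 - g\<close>. As \<open>M\<close> is independent of
  \<open>\<eta>\<close>, a sufficiently small \<open>\<eta>\<close> makes
  \<open>F \<le> \<eta>\<close> less likely than the mean of \<open>h\<close> by a margin of
  \<open>\<epsilon> / 2\<close>.\<close>

lemma correlation_lower_bound:
  fixes \<epsilon> :: real
  assumes \<epsilon>: "0 < \<epsilon>" "\<epsilon> < 1"
  shows "\<exists>\<delta>>0. \<forall>(V::'a set) q p f h. finite V \<longrightarrow> \<epsilon> < q \<longrightarrow> q + \<epsilon> < p \<longrightarrow> p < 1 - \<epsilon> \<longrightarrow>
    (\<forall>x\<subseteq>V. f x \<in> {0..1}) \<longrightarrow> (\<forall>x\<subseteq>V. h x \<in> {0..1}) \<longrightarrow>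
    (\<forall>J\<subseteq>V. card J \<le> nat \<lceil>1 / \<delta>\<rceil> \<longrightarrow>
      (\<forall>a\<subseteq>J. bexp q V f - \<delta> < bexp q (V - J) (\<lambda>b. f (a \<union> b)))) \<longrightarrow>
    \<epsilon> \<le> bexp q V f \<longrightarrow> \<epsilon> \<le> bexp p V h \<longrightarrow> \<delta> \<le> bexp p V (\<lambda>y. h y * bexp (q / p) y f)"
proof -
  define M where "M = 16 / \<epsilon>\<^sup>2 - ln (\<epsilon> / 4)"
  have M: "M > 0"
  proof -
    have "ln (\<epsilon> / 4) < 0" using \<epsilon> by simp
    moreover have "0 < 16 / \<epsilon>\<^sup>2" using \<epsilon> by simp
    ultimately show ?thesis unfolding M_def by linarith
  qed
  \<comment> \<open>Of the summand 2, one unit pays for the bad sections and one for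
    \<open>ln 2\<close>; dividing by \<open>\<epsilon> / 2\<close> prepares Markov's
    inequality.\<close>
  define l where "l = 2 * (M + 2) / \<epsilon>"
  have l: "l > 0" unfolding l_def using M \<epsilon> by simp
  define \<eta> where "\<eta> = exp (- l)"
  have \<eta>: "0 < \<eta>" "\<eta> \<le> 1" "ln \<eta> = - l" unfolding \<eta>_def using l by auto
  obtain d \<tau> where \<tau>: "\<tau> > 0" and core:
    "\<And>(V::'a set) q p f. \<lbrakk>finite V; \<epsilon> < q; q + \<epsilon> < p; p < 1 - \<epsilon>; \<forall>x\<subseteq>V. f x \<in> {0..1};
      \<epsilon> / 2 \<le> bexp q V f; \<forall>i\<in>V. infl d q V f i \<le> \<tau>\<rbrakk> \<Longrightarrow>
      ln (\<epsilon> / 4) - 16 / \<epsilon>\<^sup>2 \<le> bexp p V (\<lambda>y. ln (bexp (q / p) y f + \<eta>))"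
    using bexp_ln_thinning_ge_of_infl[OF \<epsilon> \<eta>(1), where ?'a = 'a] by blast
  \<comment> \<open>Over a bad section only the trivial bound \<open>ln \<eta> = - l\<close> is
    available, so all bad sections together cost at most \<open>l * \<beta> = 1\<close>.\<close>
  define \<beta> where "\<beta> = 1 / l"
  have \<beta>: "\<beta> > 0" unfolding \<beta>_def using l by simp
  obtain N where N: "real d < real N * (\<tau> * \<beta>)"
    using ex_less_of_nat_mult[of "\<tau> * \<beta>" "real d"] \<tau> \<beta> by auto
  \<comment> \<open>In this order, the terms keep the means of sections above
    \<open>\<epsilon> / 2\<close>, match the final correlation bound, and let regularity reach sets
    of \<open>tower N\<close> coordinates.\<close>
  define \<delta> where "\<delta> = Min {\<epsilon> / 2, \<eta> * \<epsilon> / 2, 1 / (real (tower N) + 1)}"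
  have \<delta>: "\<delta> > 0" "\<delta> \<le> \<epsilon> / 2" "\<delta> \<le> \<eta> * \<epsilon> / 2" "\<delta> \<le> 1 / (real (tower N) + 1)"
    unfolding \<delta>_def using \<epsilon> \<eta> by auto
  have tower: "tower N \<le> nat \<lceil>1 / \<delta>\<rceil>"
  proof -
    have "real (tower N) \<le> 1 / \<delta>" using \<delta>(1,4) by (simp add: field_simps)
    also have "\<dots> \<le> real (nat \<lceil>1 / \<delta>\<rceil>)" by (rule real_nat_ceiling_ge)
    finally show ?thesis by simp
  qed
  have "\<delta> \<le> bexp p V (\<lambda>y. h y * bexp (q / p) y f)"
    if V: "finite V" and q: "\<epsilon> < q" and qp: "q + \<epsilon> < p" and p: "p < 1 - \<epsilon>"
      and f: "\<forall>x\<subseteq>V. f x \<in> {0..1}" and h: "\<forall>x\<subseteq>V. h x \<in> {0..1}"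
      and reg: "\<forall>J\<subseteq>V. card J \<le> nat \<lceil>1 / \<delta>\<rceil> \<longrightarrow>
        (\<forall>a\<subseteq>J. bexp q V f - \<delta> < bexp q (V - J) (\<lambda>b. f (a \<union> b)))"
      and mf: "\<epsilon> \<le> bexp q V f" and mh: "\<epsilon> \<le> bexp p V h" for V :: "'a set" and q p f h
  proof -
    define u where "u = q / p"
    have q01: "0 < q" "q < 1" and p01: "0 \<le> p" "p \<le> 1" and u: "0 \<le> u" "u \<le> 1" "p * u = q"
      unfolding u_def using \<epsilon> q qp p by auto
    define F where "F y = bexp u y f" for y
    have F: "0 \<le> F y" "F y \<le> 1" if "y \<subseteq> V" for y
      using bexp_in_01[of y u f] u that V f unfolding F_def by (auto intro: finite_subset)
    define bad where "bad J a \<longleftrightarrow> (\<exists>i\<in>V - J. infl d q (V - J) (\<lambda>b. f (a \<union> b)) i > \<tau>)" for J a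
    obtain J where J: "J \<subseteq> V" "card J \<le> tower N" "bexp q J (\<lambda>a. of_bool (bad J a)) \<le> \<beta>"
      using uninfluential_sections[OF V q01 _ \<tau> N, of f] f unfolding bad_def by blast
    have finJ: "finite J" using J(1) V finite_subset by auto
    have "- M - l * of_bool (bad J a)
        \<le> bexp p (V - J) (\<lambda>w. ln (bexp u w (\<lambda>b. f (a \<union> b)) + \<eta>))" (is "_ \<le> ?R")
      if a: "a \<subseteq> J" for a
    proof (cases "bad J a")
      case False
      have "\<epsilon> / 2 \<le> bexp q (V - J) (\<lambda>b. f (a \<union> b))"
      proof -
        have "bexp q V f - \<delta> < bexp q (V - J) (\<lambda>b. f (a \<union> b))"
          using reg J(1) order_trans[OF J(2) tower] a by blast
        then show ?thesis using mf \<delta>(2) by linarith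
      qed
      moreover have "\<forall>x\<subseteq>V - J. f (a \<union> x) \<in> {0..1}"
        using f a J(1) by (metis Diff_subset Un_least order_trans)
      ultimately have "ln (\<epsilon> / 4) - 16 / \<epsilon>\<^sup>2 \<le> ?R"
        unfolding u_def using False V q qp p unfolding bad_def
        by (intro core) (auto simp: not_less)
      then show ?thesis using False unfolding M_def by simp
    next
      case True
      have "bexp p (V - J) (\<lambda>w. - l) \<le> ?R"
      proof (intro bexp_mono p01)
        fix w assume w: "w \<subseteq> V - J"
        have "0 \<le> bexp u w (\<lambda>b. f (a \<union> b))"
        proof (intro bexp_nonneg u)
          fix b assume "b \<subseteq> w"
          then have "a \<union> b \<subseteq> V" using w a J by auto
          then show "0 \<le> f (a \<union> b)" using f by auto
        qed
        then have "ln \<eta> \<le> ln (bexp u w (\<lambda>b. f (a \<union> b)) + \<eta>)" using \<eta>(1) by simp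
        then show "- l \<le> ln (bexp u w (\<lambda>b. f (a \<union> b)) + \<eta>)" unfolding \<eta>(3) .
      qed
      then show ?thesis using V True M by (simp add: bexp_const)
    qed
    then have "bexp q J (\<lambda>a. - M - l * of_bool (bad J a))
        \<le> bexp q J (\<lambda>a. bexp p (V - J) (\<lambda>w. ln (bexp u w (\<lambda>b. f (a \<union> b)) + \<eta>)))"
      using q01 by (intro bexp_mono) auto
    also have "\<dots> \<le> bexp p V (\<lambda>y. ln (F y + \<eta>))"
      unfolding F_def u(3)[symmetric] using f
      by (intro bexp_ln_thinning_sections V J u p01 \<eta>) auto
    \<comment> \<open>\<open>F y + \<eta>\<close> is at most \<open>2 * \<eta>\<close> if
      \<open>F y \<le> \<eta>\<close>, and at most 2 always.\<close>
    also have "\<dots> \<le> bexp p V (\<lambda>y. ln 2 - l * of_bool (F y \<le> \<eta>))"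
    proof (intro bexp_mono p01)
      fix y assume y: "y \<subseteq> V"
      show "ln (F y + \<eta>) \<le> ln 2 - l * of_bool (F y \<le> \<eta>)"
      proof (cases "F y \<le> \<eta>")
        case True
        have "ln (F y + \<eta>) \<le> ln (2 * \<eta>)" using True F[OF y] \<eta> by simp
        also have "\<dots> = ln 2 - l" using \<eta> by (simp add: ln_mult)
        finally show ?thesis using True by simp
      next
        case False
        then show ?thesis using F[OF y] \<eta> by simp
      qed
    qed
    finally have "- M - l * bexp q J (\<lambda>a. of_bool (bad J a))
        \<le> ln 2 - l * bexp p V (\<lambda>y. of_bool (F y \<le> \<eta>))"
      using V finJ by (simp add: bexp_diff bexp_cmult bexp_const)
    moreover have "l * bexp q J (\<lambda>a. of_bool (bad J a)) \<le> 1"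
      using J(3) l unfolding \<beta>_def by (simp add: field_simps)
    moreover have "ln 2 \<le> (1::real)" using ln_2_less_1 by simp
    ultimately have "l * bexp p V (\<lambda>y. of_bool (F y \<le> \<eta>)) \<le> M + 2" by linarith
    also have "\<dots> = l * (\<epsilon> / 2)" unfolding l_def using \<epsilon> by simp
    finally have small: "bexp p V (\<lambda>y. of_bool (F y \<le> \<eta>)) \<le> \<epsilon> / 2" using l by simp
    \<comment> \<open>Below, \<open>\<eta> * (h y - of_bool (F y \<le> \<eta>))\<close> is a
      pointwise lower bound for \<open>h y * F y\<close>: it is nonpositive where
      \<open>F y \<le> \<eta>\<close> and equals \<open>\<eta> * h y\<close> elsewhere.\<close>
    have "\<eta> * (\<epsilon> / 2) \<le> \<eta> * (bexp p V h - bexp p V (\<lambda>y. of_bool (F y \<le> \<eta>)))"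
      using small mh \<eta> by (intro mult_left_mono) auto
    also have "\<dots> = bexp p V (\<lambda>y. \<eta> * (h y - of_bool (F y \<le> \<eta>)))"
      unfolding bexp_cmult bexp_diff ..
    also have "\<dots> \<le> bexp p V (\<lambda>y. h y * F y)"
    proof (intro bexp_mono p01)
      fix y assume y: "y \<subseteq> V"
      have hy: "0 \<le> h y" "h y \<le> 1" using h y by auto
      show "\<eta> * (h y - of_bool (F y \<le> \<eta>)) \<le> h y * F y"
      proof (cases "F y \<le> \<eta>")
        case True
        have "\<eta> * (h y - 1) \<le> 0" using hy \<eta> by (simp add: mult_nonneg_nonpos)
        moreover have "0 \<le> h y * F y" using hy F[OF y] by simp
        ultimately show ?thesis using True by simp
      next
        case False
        then have "h y * \<eta> \<le> h y * F y" using hy by (intro mult_left_mono) auto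
        then show ?thesis using False by (simp add: mult.commute)
      qed
    qed
    finally show ?thesis using \<delta>(3) unfolding F_def u_def by simp
  qed
  with \<delta>(1) show ?thesis by blast
qed

subsection \<open>Transfer to product measures\<close>

text \<open>Stated for any finite value type, to serve both single bits and coupled pairs of
  bits.\<close>

lemma expectation_Pi_pmf_insert:
  fixes P :: "'b::finite pmf" and h :: "('a \<Rightarrow> 'b) \<Rightarrow> real"
  assumes "finite I" "i \<notin> I"
  shows "measure_pmf.expectation (Pi_pmf (insert i I) d (\<lambda>_. P)) h
    = measure_pmf.expectation P (\<lambda>b. measure_pmf.expectation (Pi_pmf I d (\<lambda>_. P)) (\<lambda>g. h (g(i := b))))"
proof -
  have fin: "finite (set_pmf (Pi_pmf I d (\<lambda>_. P)))"
    using assms(1) by (simp add: set_Pi_pmf finite_PiE_dflt)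
  have "Pi_pmf (insert i I) d (\<lambda>_. P)
      = bind_pmf P (\<lambda>b. map_pmf (\<lambda>g. g(i := b)) (Pi_pmf I d (\<lambda>_. P)))"
    unfolding Pi_pmf_insert'[OF assms] map_pmf_def ..
  also have "measure_pmf.expectation \<dots> h
      = (\<Sum>b\<in>UNIV. pmf P b *\<^sub>R
          measure_pmf.expectation (map_pmf (\<lambda>g. g(i := b)) (Pi_pmf I d (\<lambda>_. P))) h)"
    using fin by (intro pmf_expectation_bind) auto
  also have "\<dots> = measure_pmf.expectation P
      (\<lambda>b. measure_pmf.expectation (Pi_pmf I d (\<lambda>_. P)) (\<lambda>g. h (g(i := b))))"
    by (subst integral_measure_pmf[of UNIV]) (auto simp: integral_map_pmf)
  finally show ?thesis .
qed

lemma indicator_fun_upd: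
  "(\<lambda>j. j \<in> A)(i := True) = (\<lambda>j. j \<in> insert i A)"
  "A \<subseteq> I \<Longrightarrow> i \<notin> I \<Longrightarrow> (\<lambda>j. j \<in> A)(i := False) = (\<lambda>j. j \<in> A)"
  by (auto simp: fun_eq_iff)

lemma mean_eq_bexp:
  assumes "finite I" "0 \<le> p" "p \<le> 1"
  shows "mean I p f = bexp p I (\<lambda>x. f (\<lambda>i. i \<in> x))"
  using assms(1) unfolding mean_def biased_def
proof (induction I arbitrary: f rule: finite_induct)
  case (insert i I)
  have 0: "bexp p I (\<lambda>x. f ((\<lambda>j. j \<in> x)(i := False))) = bexp p I (\<lambda>x. f (\<lambda>j. j \<in> x))"
    by (intro bexp_cong) (simp only: indicator_fun_upd(2)[OF _ insert.hyps(2)])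
  show ?case
    unfolding expectation_Pi_pmf_insert[OF insert.hyps] insert.IH bexp_insert[OF insert.hyps]
    using assms 0 by (simp add: integral_bernoulli_pmf indicator_fun_upd(1))
qed simp

lemma expectation_coupled_bit:
  fixes G :: "bool \<times> bool \<Rightarrow> real"
  assumes "0 \<le> p" "p \<le> 1" "0 \<le> q / p" "q / p \<le> 1"
  shows "measure_pmf.expectation (coupled_bit q p) G = p * (q / p * G (True, True)
    + (1 - q / p) * G (False, True)) + (1 - p) * G (False, False)"
proof -
  define u where "u = q / p"
  have "measure_pmf.expectation (pair_pmf (bernoulli_pmf p) (bernoulli_pmf u))
      (\<lambda>(y, k). G (y \<and> k, y))
    = (\<Sum>y\<in>UNIV. \<Sum>k\<in>UNIV. pmf (bernoulli_pmf p) y * pmf (bernoulli_pmf u) k * G (y \<and> k, y))"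
    by (subst integral_measure_pmf[of UNIV])
      (auto simp: pmf_pair sum.cartesian_product intro!: sum.cong)
  also have "\<dots> = p * (u * G (True, True) + (1 - u) * G (False, True)) + (1 - p) * G (False, False)"
    using assms unfolding u_def[symmetric] by (simp add: UNIV_bool algebra_simps)
  finally show ?thesis
    unfolding coupled_bit_def integral_map_pmf u_def by (simp add: case_prod_unfold)
qed

text \<open>The coupling draws a \<open>p\<close>-random set \<open>y\<close> and thins it with
  \<open>q / p\<close>. \<open>H\<close> varies in the induction, since fixing the pair at
  \<open>i\<close> changes it.\<close>

lemma expectation_coupled:
  fixes H :: "('a \<Rightarrow> bool) \<Rightarrow> ('a \<Rightarrow> bool) \<Rightarrow> real"
  assumes "finite I" "0 \<le> p" "p \<le> 1" "0 \<le> q / p" "q / p \<le> 1"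
  shows "measure_pmf.expectation (coupled I q p) (\<lambda>(x, y). H x y)
    = bexp p I (\<lambda>y. bexp (q / p) y (\<lambda>x. H (\<lambda>i. i \<in> x) (\<lambda>i. i \<in> y)))"
proof -
  define u where "u = q / p"
  have "measure_pmf.expectation (Pi_pmf I (False, False) (\<lambda>_. coupled_bit q p))
      (\<lambda>w. H (\<lambda>i. fst (w i)) (\<lambda>i. snd (w i)))
    = bexp p I (\<lambda>y. bexp u y (\<lambda>x. H (\<lambda>i. i \<in> x) (\<lambda>i. i \<in> y)))"
    using assms(1)
  proof (induction I arbitrary: H rule: finite_induct)
    case (insert i I)
    \<comment> \<open>The inner expectation with the pair at \<open>i\<close> fixed to
      \<open>(a, b)\<close>.\<close>
    define K where "K a b y = bexp u y (\<lambda>x. H ((\<lambda>j. j \<in> x)(i := a)) ((\<lambda>j. j \<in> y)(i := b)))"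
      for a b y
    have K: "measure_pmf.expectation (Pi_pmf I (False, False) (\<lambda>_. coupled_bit q p))
        (\<lambda>w. H (\<lambda>j. fst ((w(i := (a, b))) j)) (\<lambda>j. snd ((w(i := (a, b))) j)))
      = bexp p I (K a b)" for a b
    proof -
      have "(\<lambda>j. fst ((w(i := (a, b))) j)) = (\<lambda>j. fst (w j))(i := a)"
        "(\<lambda>j. snd ((w(i := (a, b))) j)) = (\<lambda>j. snd (w j))(i := b)" for w :: "'a \<Rightarrow> bool \<times> bool"
        by auto
      then show ?thesis
        using insert.IH[of "\<lambda>x y. H (x(i := a)) (y(i := b))"] unfolding K_def by simp
    qed
    have "bexp u (insert i y) (\<lambda>x. H (\<lambda>i. i \<in> x) (\<lambda>j. j \<in> insert i y))
        = u * K True True y + (1 - u) * K False True y" if "y \<subseteq> I" for y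
    proof -
      have y: "finite y" "i \<notin> y" using that insert.hyps finite_subset by auto
      have "bexp u y (\<lambda>x. H (\<lambda>j. j \<in> x) (\<lambda>j. j \<in> insert i y)) = K False True y"
        unfolding K_def indicator_fun_upd(1)
        by (intro bexp_cong) (simp only: indicator_fun_upd(2)[OF _ y(2)])
      then show ?thesis
        unfolding bexp_insert[OF y] unfolding K_def indicator_fun_upd(1) by simp
    qed
    note A1 = this
    have A0: "bexp u y (\<lambda>x. H (\<lambda>i. i \<in> x) (\<lambda>i. i \<in> y)) = K False False y" if "y \<subseteq> I" for y
    proof -
      have y: "i \<notin> y" using that insert.hyps by auto
      show ?thesis
        unfolding K_def
        by (intro bexp_cong) (simp only: indicator_fun_upd(2)[OF _ y] subset_refl)
    qed
    have "bexp p (insert i I) (\<lambda>y. bexp u y (\<lambda>x. H (\<lambda>i. i \<in> x) (\<lambda>i. i \<in> y)))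
      = p * bexp p I (\<lambda>y. u * K True True y + (1 - u) * K False True y)
        + (1 - p) * bexp p I (K False False)"
      unfolding bexp_insert[OF insert.hyps]
      by (intro arg_cong2[where f = "(+)"] arg_cong2[where f = "(*)"] refl bexp_cong A1 A0)
    then show ?case
      unfolding expectation_Pi_pmf_insert[OF insert.hyps] K
        expectation_coupled_bit[OF assms(2-5)] u_def[symmetric]
      by (simp only: bexp_add bexp_cmult)
  qed simp
  then show ?thesis
    unfolding coupled_def u_def integral_map_pmf by simp
qed

lemma indicator_in_cube: "A \<subseteq> I \<Longrightarrow> (\<lambda>i. i \<in> A) \<in> cube I"
  by (auto simp: cube_def PiE_dflt_def)

lemma mean_restriction:
  assumes "finite I" "0 \<le> p" "p \<le> 1" "a \<subseteq> J"
  shows "mean (I - J) p (restriction f J (\<lambda>i. i \<in> a)) = bexp p (I - J) (\<lambda>b. f (\<lambda>i. i \<in> a \<union> b))"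
proof -
  have "override_on (\<lambda>i. i \<in> b) (\<lambda>i. i \<in> a) J = (\<lambda>i. i \<in> a \<union> b)" if "b \<subseteq> I - J" for b
    using that assms(4) by (auto simp: override_on_def fun_eq_iff)
  then have "bexp p (I - J) (\<lambda>b. restriction f J (\<lambda>i. i \<in> a) (\<lambda>i. i \<in> b))
      = bexp p (I - J) (\<lambda>b. f (\<lambda>i. i \<in> a \<union> b))"
    unfolding restriction_def by (intro bexp_cong) (rule arg_cong[where f = f])
  then show ?thesis
    using assms by (simp add: mean_eq_bexp)
qed

theorem theorem2p8:
  fixes \<epsilon> :: real
  assumes "\<epsilon> > 0"
  shows "\<exists>\<delta>>0. \<forall>(n::nat) (q::real) (p::real) (f::(nat \<Rightarrow> bool) \<Rightarrow> real) (g::(nat \<Rightarrow> bool) \<Rightarrow> real).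
    q \<in> {\<epsilon><..<1 - \<epsilon>} \<longrightarrow> p \<in> {\<epsilon><..<1 - \<epsilon>} \<longrightarrow> p > q + \<epsilon> \<longrightarrow>
    f \<in> cube {1..n} \<rightarrow> {0..1} \<longrightarrow> g \<in> cube {1..n} \<rightarrow> {0..1} \<longrightarrow>
    measure_pmf.expectation (coupled {1..n} q p) (\<lambda>(x, y). (1 - g y) * f x) < \<delta> \<longrightarrow>
    regular {1..n} (nat \<lceil>1 / \<delta>\<rceil>) \<delta> q f \<longrightarrow>
    mean {1..n} q f < \<epsilon> \<or> mean {1..n} p g > 1 - \<epsilon>"
proof (cases "\<epsilon> < 1")
  case False
  \<comment> \<open>For \<open>\<epsilon> \<ge> 1\<close> the interval for \<open>q\<close> is
    empty, so any positive \<delta> works.\<close>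
  then show ?thesis by (intro exI[of _ 1]) auto
next
  case True
  obtain \<delta> where \<delta>: "\<delta> > 0" and bound:
    "\<And>(V::nat set) q p f h. \<lbrakk>finite V; \<epsilon> < q; q + \<epsilon> < p; p < 1 - \<epsilon>;
      \<forall>x\<subseteq>V. f x \<in> {0..1}; \<forall>x\<subseteq>V. h x \<in> {0..1};
      \<forall>J\<subseteq>V. card J \<le> nat \<lceil>1 / \<delta>\<rceil> \<longrightarrow>
        (\<forall>a\<subseteq>J. bexp q V f - \<delta> < bexp q (V - J) (\<lambda>b. f (a \<union> b)));
      \<epsilon> \<le> bexp q V f; \<epsilon> \<le> bexp p V h\<rbrakk> \<Longrightarrow> \<delta> \<le> bexp p V (\<lambda>y. h y * bexp (q / p) y f)"
    using correlation_lower_bound[OF assms True, where ?'a = nat] by blast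
  have "mean {1..n} q f < \<epsilon> \<or> mean {1..n} p g > 1 - \<epsilon>"
    if q: "q \<in> {\<epsilon><..<1 - \<epsilon>}" and p: "p \<in> {\<epsilon><..<1 - \<epsilon>}" and qp: "p > q + \<epsilon>"
      and f: "f \<in> cube {1..n} \<rightarrow> {0..1}" and g: "g \<in> cube {1..n} \<rightarrow> {0..1}"
      and E: "measure_pmf.expectation (coupled {1..n} q p) (\<lambda>(x, y). (1 - g y) * f x) < \<delta>"
      and reg: "regular {1..n} (nat \<lceil>1 / \<delta>\<rceil>) \<delta> q f"
    for n q p and f g :: "(nat \<Rightarrow> bool) \<Rightarrow> real"
  proof (rule ccontr)
    assume "\<not> ?thesis"
    then have mf: "\<epsilon> \<le> mean {1..n} q f" and mg: "mean {1..n} p g \<le> 1 - \<epsilon>" by auto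
    define V where "V = {1..n}"
    have V: "finite V" unfolding V_def by simp
    have q01: "0 \<le> q" "q \<le> 1" and p01: "0 \<le> p" "p \<le> 1" and u: "0 \<le> q / p" "q / p \<le> 1"
      using assms q p qp by auto
    define f' where "f' x = f (\<lambda>i. i \<in> x)" for x
    \<comment> \<open>The negated conclusion for \<open>g\<close> says that \<open>h\<close> has
      mean at least \<open>\<epsilon>\<close>.\<close>
    define h where "h x = 1 - g (\<lambda>i. i \<in> x)" for x
    have mf': "mean V q f = bexp q V f'"
      unfolding f'_def by (rule mean_eq_bexp[OF V q01])
    have "\<delta> \<le> bexp p V (\<lambda>y. h y * bexp (q / p) y f')"
    proof (rule bound)
      show "\<forall>x\<subseteq>V. f' x \<in> {0..1}"
        using f indicator_in_cube unfolding f'_def V_def by blast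
      have "g (\<lambda>i. i \<in> x) \<in> {0..1}" if "x \<subseteq> V" for x
        using g indicator_in_cube[OF that] unfolding V_def by blast
      then show "\<forall>x\<subseteq>V. h x \<in> {0..1}" unfolding h_def by simp
      show "\<forall>J\<subseteq>V. card J \<le> nat \<lceil>1 / \<delta>\<rceil> \<longrightarrow>
        (\<forall>a\<subseteq>J. bexp q V f' - \<delta> < bexp q (V - J) (\<lambda>b. f' (a \<union> b)))"
      proof (intro allI impI)
        fix J a assume J: "J \<subseteq> V" "card J \<le> nat \<lceil>1 / \<delta>\<rceil>" and a: "a \<subseteq> J"
        have "\<bar>mean (V - J) q (restriction f J (\<lambda>i. i \<in> a)) - mean V q f\<bar> < \<delta>"
          using reg J indicator_in_cube[OF a] unfolding regular_def V_def by blast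
        then show "bexp q V f' - \<delta> < bexp q (V - J) (\<lambda>b. f' (a \<union> b))"
          unfolding mf' mean_restriction[OF V q01 a] f'_def by linarith
      qed
      show "\<epsilon> \<le> bexp q V f'" using mf mf' unfolding V_def by simp
      show "\<epsilon> \<le> bexp p V h"
        using mg V mean_eq_bexp[OF V p01, of g] unfolding h_def V_def[symmetric]
        by (simp add: bexp_diff bexp_const)
    qed (use V q p qp in auto)
    also have "\<dots> = measure_pmf.expectation (coupled V q p) (\<lambda>(x, y). (1 - g y) * f x)"
      unfolding expectation_coupled[OF V p01 u] h_def f'_def bexp_cmult ..
    finally show False using E unfolding V_def by simp
  qed
  with \<delta> show ?thesis by blast
qed

end
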